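(* Let $\{(\mathbf u_h^n,p_h^n,\boldsymbol\lambda_h^n,\dot{\mathbf d}_h^{n-\frac12},\mathbf d_h^n,\dot{\mathbf d}_h^n)\}_{n=1}^N\subset \mathbf V_h\times Q_h\times\boldsymbol\Lambda_h\times\mathbf W_h\times\mathbf W_h\times\mathbf W_h$ be produced by the splitting algorithm (described in the context) with extrapolation order $r\in\{1,2\}$ and initial data $\mathbf u_{0,h}\in\mathbf V_h$, $\mathbf d_{0,h},\mathbf d_{1,h},\boldsymbol\phi_{0,h}\in\mathbf W_h$. Define $$E_h^0=\rho^{\rm f}\|\mathbf u_{0,h}\|^2_{0,\Omega}+\rho^{\rm s}\varepsilon\|\mathbf d_{1,h}\|^2_{0,\Sigma}+\|\mathbf d_{0,h}\|_{\rm s}^2,\qquad E_h^n=\rho^{\rm f}\|\mathbf u_h^n\|^2_{0,\Omega}+\rho^{\rm s}\varepsilon\|\dot{\mathbf d}_h^n\|^2_{0,\Sigma}+\|\mathbf d_h^n\|_{\rm s}^2,$$ $$D_h^n=\sum_{m=1}^n\tau\left(4\mu\|\boldsymbol\epsilon(\mathbf u_h^m)\|^2_{0,\Omega}+2|p_h^m|^2_{s_h}\right).$$ (i) If $r=1$, then for all $1\le n\le N$ (with no restriction on $\tau$) $$E_h^n+D_h^n+\tau^2\|\dot{\mathbf d}_h^n\|_{\rm s}^2+\frac{\tau^2}{\rho^{\rm s}\varepsilon}\|\mathbf L_h\mathbf d_h^n\|^2_{0,\Sigma}\le E_h^0+\tau^2\|\mathbf d_{1,h}\|_{\rm s}^2+\frac{\tau^2}{\rho^{\rm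 s}\varepsilon}\|\mathbf L_h\mathbf d_{0,h}\|^2_{0,\Sigma}.$$ (ii) If $r=2$, the mesh $\mathcal S_h$ is quasi-uniform, and there exists $\alpha>0$ such that $$\tau\le\alpha\left(\frac{\rho^{\rm s}\varepsilon}{C_{\rm I}}\right)^{2/3}h_{\rm s}^{4/3}\qquad\text{and}\qquad 2\tau\alpha^3<1,$$ then for all $1\le n\le N$, with $t_n=n\tau$, $$E_h^n+D_h^n\le\exp\left(\frac{2\alpha^3t_n}{1-2\tau\alpha^3}\right)E_h^0 .$$
   Context: Setting. $\Omega\subset\mathbb R^d$, $d\in\{2,3\}$, is a bounded Lipschitz domain; $\Sigma\subset\mathbb R^d$ is the reference mid-surface of a thin structure (a curve if $d=2$, a surface if $d=3$). $\rho^{\rm f},\mu>0$ are fluid density and viscosity, $\rho^{\rm s}\varepsilon>0$ is the solid density times thickness. $(\cdot,\cdot)$ and $(\cdot,\cdot)_\Sigma$ are the $L^2(\Omega)$ and $L^2(\Sigma)$ inner products, with norms $\|\cdot\|_{0,\Omega}$, $\|\cdot\|_{0,\Sigma}$. $\boldsymbol\epsilon(\mathbf u)=(\nabla\mathbf u+\nabla\mathbf u^\top)/2$. $\mathbf W\subseteq H^1(\Sigma)^d$ is the subspace of admissible displacements satisfying the homogeneous Dirichlet condition on $\partial\Sigma$. $a^{\rm s}:\mathbf W\times\mathbf W\to\mathbb R$ is a bilinear form, symmetric, continuous and coercive on $\mathbf W$, with norm $\|\mathbf w\|_{\rm s}^2=a^{\rm s}(\mathbf w,\mathbf w)$ (it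 is associated with a linear surface elastic operator $\mathbf L$, $a^{\rm s}(\mathbf d,\mathbf w)=(\mathbf L\mathbf d,\mathbf w)_\Sigma$). $L^2_0(\Omega)$ denotes zero-mean $L^2$ functions. Forms: $a^{\rm f}((\mathbf u,p),(\mathbf v,q))=2\mu(\boldsymbol\epsilon(\mathbf u),\boldsymbol\epsilon(\mathbf v))-(\operatorname{div}\mathbf v,p)+(\operatorname{div}\mathbf u,q)$; $b(\mathbf z,\mathbf u,\mathbf v)=\frac{\rho^{\rm f}}2\big((\mathbf z\cdot\nabla\mathbf u,\mathbf v)-(\mathbf z\cdot\nabla\mathbf v,\mathbf u)\big)$; $c(\boldsymbol\mu,\mathbf w)=\langle\boldsymbol\mu,\mathbf w\rangle$ is the duality pairing between $(H^{1/2}(\Sigma)^d)'$ and $H^{1/2}(\Sigma)^d$ (equal to $(\boldsymbol\mu,\mathbf w)_\Sigma$ for $L^2$ functions). Discrete spaces: $\mathcal T_h$ is a regular simplicial mesh of $\Omega$, $\mathcal S_h$ a regular simplicial mesh of $\Sigma$ (segments or triangles) with mesh size $h_{\rm s}$; $\mathbf V_h=\{\mathbf v\in H^1_0(\Omega)^d:\mathbf v|_K\in\mathbb P_1^d\ \forall K\in\mathcal T_h\}$, $Q_h=\{q\in L^2_0(\Omega):q|_K\in\mathbb P_1\ \forall K\in\mathcal T_h\}$, $\mathbf W_h=\{\mathbf w\in\mathbf W:\mathbf w|_K\in\mathbb P_1^d\ \forall K\in\mathcal S_h\}$, $\boldsymbol\Lambda_h=\{\boldsymbol\mu\in H^1(\Sigma)^d:\boldsymbol\mu|_K\in\mathbb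 P_1^d\ \forall K\in\mathcal S_h\}$. Stabilization: $s_h(p,q)=\gamma\sum_{K\in\mathcal T_h}h_K^2(\nabla p,\nabla q)_K$ with fixed $\gamma>0$, $h_K$ the diameter of $K$, $|q|_{s_h}^2=s_h(q,q)$, and $a^{\rm f}_h((\mathbf u,p),(\mathbf v,q))=a^{\rm f}((\mathbf u,p),(\mathbf v,q))+s_h(p,q)$. The discrete elastic operator $\mathbf L_h:\mathbf W\to\mathbf W_h$ is defined by $(\mathbf L_h\mathbf w,\mathbf z)_\Sigma=a^{\rm s}(\mathbf w,\mathbf z)$ for all $\mathbf z\in\mathbf W_h$. When $\mathcal S_h$ is quasi-uniform, $C_{\rm I}>0$ denotes a constant (independent of $h_{\rm s}$) such that $\|\mathbf L_h\mathbf w_h\|_{\rm s}\le C_{\rm I}h_{\rm s}^{-2}\|\mathbf w_h\|_{\rm s}$ for all $\mathbf w_h\in\mathbf W_h$. Splitting algorithm. Let $T>0$, $N\ge1$, $\tau=T/N$, $t_n=n\tau$, $\partial_\tau g^n=(g^n-g^{n-1})/\tau$. Set $\mathbf u_h^0=\mathbf u_{0,h}$, $\mathbf d_h^0=\mathbf d_{0,h}$, $\dot{\mathbf d}_h^0=\mathbf d_{1,h}$, $\boldsymbol\phi_h^0=\boldsymbol\phi_{0,h}$. The extrapolated displacement is $\mathbf d_h^{n*}=\mathbf d_h^{n-1}$ if $r=1$ and $\mathbf d_h^{n*}=\mathbf d_h^{n-1}+\tau\dot{\mathbf d}_h^{n-1}$ if $r=2$. For $n=1,\dots,N$: Step 1: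 find $(\mathbf u_h^n,p_h^n,\boldsymbol\lambda_h^n,\dot{\mathbf d}_h^{n-\frac12})\in\mathbf V_h\times Q_h\times\boldsymbol\Lambda_h\times\mathbf W_h$ with $$\rho^{\rm f}(\partial_\tau\mathbf u_h^n,\mathbf v)+b(\mathbf u_h^{n-1},\mathbf u_h^n,\mathbf v)+a^{\rm f}_h((\mathbf u_h^n,p_h^n),(\mathbf v,q))+c(\boldsymbol\lambda_h^n,\mathbf v\circ\boldsymbol\phi_h^{n-1})-c(\boldsymbol\mu,\mathbf u_h^n\circ\boldsymbol\phi_h^{n-1}-\dot{\mathbf d}_h^{n-\frac12})=0$$ for all $(\mathbf v,q,\boldsymbol\mu)\in\mathbf V_h\times Q_h\times\boldsymbol\Lambda_h$, and $$\frac{\rho^{\rm s}\varepsilon}{\tau}(\dot{\mathbf d}_h^{n-\frac12}-\dot{\mathbf d}_h^{n-1},\mathbf w)_\Sigma=c(\boldsymbol\lambda_h^n,\mathbf w)-a^{\rm s}(\mathbf d_h^{n*},\mathbf w)\quad\forall\mathbf w\in\mathbf W_h.$$ Step 2: find $(\mathbf d_h^n,\dot{\mathbf d}_h^n)\in\mathbf W_h\times\mathbf W_h$ with $$\rho^{\rm s}\varepsilon(\partial_\tau\dot{\mathbf d}_h^n,\mathbf w)_\Sigma+a^{\rm s}(\mathbf d_h^n,\mathbf w)=c(\boldsymbol\lambda_h^n,\mathbf w)\quad\forall\mathbf w\in\mathbf W_h,\qquad\dot{\mathbf d}_h^n=\partial_\tau\mathbf d_h^n.$$ Step 3: $\boldsymbol\phi_h^n=\boldsymbol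 I+\mathbf d_h^n$, where $\boldsymbol I$ is the identity map on $\Sigma$. It is assumed throughout that the maps $\boldsymbol\phi_h^{n}$ take values in $\Omega$, so that the compositions make sense. *)

theory Defs
  imports "HOL-Analysis.Analysis"
begin

definition L2 :: "'a measure \<Rightarrow> ('a \<Rightarrow> 'b::euclidean_space) set" where
  "L2 M = {f \<in> borel_measurable M. integrable M (\<lambda>x. (norm (f x))\<^sup>2)}"

definition L2_inner :: "'a measure \<Rightarrow> ('a \<Rightarrow> 'b::euclidean_space) \<Rightarrow> ('a \<Rightarrow> 'b) \<Rightarrow> real" where
  "L2_inner M f g = (LINT x|M. f x \<bullet> g x)"

definition L2_norm :: "'a measure \<Rightarrow> ('a \<Rightarrow> 'b::euclidean_space) \<Rightarrow> real" where
  "L2_norm M f = sqrt (L2_inner M f f)"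

text \<open>The membership in \<open>L2\<close> is part of the definition because the Lebesgue integral of a
  non-integrable function is 0.\<close>
definition L2_close :: "'a measure \<Rightarrow> real \<Rightarrow> ('a \<Rightarrow> 'b::euclidean_space) \<Rightarrow> ('a \<Rightarrow> 'b) \<Rightarrow> bool" where
  "L2_close M e f g \<longleftrightarrow> (\<lambda>x. f x - g x) \<in> L2 M \<and> L2_norm M (\<lambda>x. f x - g x) < e"

definition C1_with_grad :: "('a::euclidean_space \<Rightarrow> real) \<Rightarrow> ('a \<Rightarrow> 'a) \<Rightarrow> bool" where
  "C1_with_grad \<phi> D \<longleftrightarrow>
     (\<forall>x. (\<phi> has_derivative (\<lambda>h. D x \<bullet> h)) (at x)) \<and> continuous_on UNIV D"

definition test_function :: "'a::euclidean_space set \<Rightarrow> ('a \<Rightarrow> real) \<Rightarrow> ('a \<Rightarrow> 'a) \<Rightarrow> bool" where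
  "test_function U \<phi> D \<longleftrightarrow>
     C1_with_grad \<phi> D \<and> compact (closure {x. \<phi> x \<noteq> 0}) \<and> closure {x. \<phi> x \<noteq> 0} \<subseteq> U"

definition is_weak_grad :: "'a::euclidean_space set \<Rightarrow> ('a \<Rightarrow> real) \<Rightarrow> ('a \<Rightarrow> 'a) \<Rightarrow> bool" where
  "is_weak_grad U f g \<longleftrightarrow>
     f \<in> L2 (lebesgue_on U) \<and> g \<in> L2 (lebesgue_on U) \<and>
     (\<forall>\<phi> D. test_function U \<phi> D \<longrightarrow>
        (LINT x|lebesgue_on U. f x *\<^sub>R D x) = - (LINT x|lebesgue_on U. \<phi> x *\<^sub>R g x))"

text \<open>The choice is harmless: weak gradients are unique up to a null set.\<close>
definition weak_grad :: "'a::euclidean_space set \<Rightarrow> ('a \<Rightarrow> real) \<Rightarrow> 'a \<Rightarrow> 'a" where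
  "weak_grad U f = (SOME g. is_weak_grad U f g)"

text \<open>\<open>H\<^sup>1\<^sub>0(U)\<close> is the closure of the test functions in \<open>H\<^sup>1(U)\<close>.\<close>
definition H1_0 :: "'a::euclidean_space set \<Rightarrow> ('a \<Rightarrow> real) set" where
  "H1_0 U = {f. \<exists>g. is_weak_grad U f g \<and>
     (\<forall>e>0. \<exists>\<phi> D. test_function U \<phi> D \<and>
        L2_close (lebesgue_on U) e f \<phi> \<and> L2_close (lebesgue_on U) e g D)}"

definition componentwise :: "('a \<Rightarrow> real) set \<Rightarrow> ('a \<Rightarrow> real ^ 'n) set" where
  "componentwise X = {v. \<forall>i. (\<lambda>x. v x $ i) \<in> X}"

text \<open>Row \<open>i\<close> of the matrix is the gradient of the \<open>i\<close>-th component.\<close>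
definition weak_jac :: "(real ^ 'd) set \<Rightarrow> (real ^ 'd \<Rightarrow> real ^ 'd) \<Rightarrow> real ^ 'd \<Rightarrow> real ^ 'd ^ 'd" where
  "weak_jac U v x = (\<chi> i. weak_grad U (\<lambda>y. v y $ i) x)"

definition sym_grad :: "(real ^ 'd) set \<Rightarrow> (real ^ 'd \<Rightarrow> real ^ 'd) \<Rightarrow> real ^ 'd \<Rightarrow> real ^ 'd ^ 'd" where
  "sym_grad U v x = (1 / 2) *\<^sub>R (weak_jac U v x + transpose (weak_jac U v x))"

definition weak_div :: "(real ^ 'd) set \<Rightarrow> (real ^ 'd \<Rightarrow> real ^ 'd) \<Rightarrow> real ^ 'd \<Rightarrow> real" where
  "weak_div U v x = trace (weak_jac U v x)"

definition lipschitz_domain :: "'a::euclidean_space set \<Rightarrow> bool" where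
  "lipschitz_domain U \<longleftrightarrow> open U \<and> connected U \<and> U \<noteq> {} \<and>
     (\<forall>x\<in>frontier U. \<exists>r>0. \<exists>e g L. norm e = 1 \<and> L-lipschitz_on {z. z \<bullet> e = 0} g \<and>
        U \<inter> ball x r = {y \<in> ball x r. g (y - (y \<bullet> e) *\<^sub>R e) < y \<bullet> e})"

definition hausdorff_content :: "nat \<Rightarrow> real \<Rightarrow> 'a::metric_space set \<Rightarrow> ennreal" where
  "hausdorff_content s \<delta> A =
     (INF C \<in> {C :: nat \<Rightarrow> 'a set. A \<subseteq> (\<Union>i. C i) \<and> (\<forall>i. bounded (C i) \<and> diameter (C i) \<le> \<delta>)}.
        \<Sum>i. ennreal (unit_ball_vol (real s) * (diameter (C i) / 2) ^ s))"

text \<open>The factor \<open>unit_ball_vol\<close> normalises the measure to agree with the length for \<open>s = 1\<close> and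
  with the area for \<open>s = 2\<close>.\<close>
definition hausdorff_measure :: "nat \<Rightarrow> 'a::metric_space measure" where
  "hausdorff_measure s =
     measure_of UNIV (sets borel) (\<lambda>A. SUP \<delta>\<in>{0<..}. hausdorff_content s \<delta> A)"

definition surface_measure :: "'a::euclidean_space set \<Rightarrow> 'a measure" where
  "surface_measure S = restrict_space (hausdorff_measure (DIM('a) - 1)) S"

definition bilipschitz_chart ::
  "'a::euclidean_space set \<Rightarrow> 'a set \<Rightarrow> ('a \<Rightarrow> 'a) \<Rightarrow> bool" where
  "bilipschitz_chart A B \<psi> \<longleftrightarrow>
     (\<exists>\<psi>' L L'. homeomorphism A B \<psi> \<psi>' \<and> L-lipschitz_on A \<psi> \<and> L'-lipschitz_on B \<psi>')"

text \<open>The hyperplane orthogonal to \<open>e\<close>, and a half of it, are the model spaces for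
  interior points and for boundary points.\<close>
definition surface_interior_point :: "'a::euclidean_space set \<Rightarrow> 'a \<Rightarrow> bool" where
  "surface_interior_point S x \<longleftrightarrow>
     (\<exists>U V e \<psi>. open U \<and> x \<in> U \<and> open V \<and> norm e = 1 \<and>
        bilipschitz_chart (S \<inter> U) ({y. y \<bullet> e = 0} \<inter> V) \<psi>)"

definition surface_boundary_point :: "'a::euclidean_space set \<Rightarrow> 'a \<Rightarrow> bool" where
  "surface_boundary_point S x \<longleftrightarrow>
     (\<exists>U V e f \<psi>. open U \<and> x \<in> U \<and> open V \<and> norm e = 1 \<and> norm f = 1 \<and> e \<bullet> f = 0 \<and>
        bilipschitz_chart (S \<inter> U) ({y. y \<bullet> e = 0 \<and> y \<bullet> f \<ge> 0} \<inter> V) \<psi> \<and> \<psi> x \<bullet> f = 0)"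

definition lipschitz_surface :: "'a::euclidean_space set \<Rightarrow> bool" where
  "lipschitz_surface S \<longleftrightarrow> compact S \<and> S \<noteq> {} \<and>
     (\<forall>x\<in>S. surface_interior_point S x \<or> surface_boundary_point S x)"

definition surface_boundary :: "'a::euclidean_space set \<Rightarrow> 'a set" where
  "surface_boundary S = {x \<in> S. surface_boundary_point S x}"

text \<open>The span of the contingent cone; for a Lipschitz surface this is a hyperplane at almost every
  point.\<close>
definition tangent_space :: "'a::euclidean_space set \<Rightarrow> 'a \<Rightarrow> 'a set" where
  "tangent_space S x = span {v. \<exists>y t. (\<forall>k::nat. y k \<in> S \<and> 0 < t k) \<and> y \<longlonglongrightarrow> x \<and> t \<longlonglongrightarrow> 0 \<and>
     (\<lambda>k. (y k - x) /\<^sub>R t k) \<longlonglongrightarrow> v}"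

text \<open>On a subspace, \<open>closest_point\<close> is the orthogonal projection.\<close>
definition tangential_part :: "'a::euclidean_space set \<Rightarrow> ('a \<Rightarrow> 'a) \<Rightarrow> 'a \<Rightarrow> 'a" where
  "tangential_part S D x = closest_point (tangent_space S x) (D x)"

text \<open>\<open>H\<^sup>1(S)\<close> is the completion of the restrictions of \<open>C\<^sup>1\<close> functions with respect to the \<open>L\<^sup>2\<close> norms
  of the function and of its tangential gradient. Functions on \<open>S\<close> are represented by
  functions on the ambient space that vanish outside \<open>S\<close>.\<close>
definition is_surface_grad :: "'a::euclidean_space set \<Rightarrow> ('a \<Rightarrow> real) \<Rightarrow> ('a \<Rightarrow> 'a) \<Rightarrow> bool" where
  "is_surface_grad S f g \<longleftrightarrow>
     f \<in> L2 (surface_measure S) \<and> g \<in> L2 (surface_measure S) \<and>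
     (\<forall>e>0. \<exists>\<phi> D. C1_with_grad \<phi> D \<and>
        L2_close (surface_measure S) e f \<phi> \<and>
        L2_close (surface_measure S) e g (tangential_part S D))"

definition surface_grad :: "'a::euclidean_space set \<Rightarrow> ('a \<Rightarrow> real) \<Rightarrow> 'a \<Rightarrow> 'a" where
  "surface_grad S f = (SOME g. is_surface_grad S f g)"

definition H1_surface :: "'a::euclidean_space set \<Rightarrow> ('a \<Rightarrow> real) set" where
  "H1_surface S = {f. (\<forall>x. x \<notin> S \<longrightarrow> f x = 0) \<and> (\<exists>g. is_surface_grad S f g)}"

text \<open>The functions in \<open>H\<^sup>1(S)\<close> with zero trace on the boundary of \<open>S\<close>: the closure of the \<open>C\<^sup>1\<close>
  functions supported away from the boundary.\<close>
definition H1_0_surface :: "'a::euclidean_space set \<Rightarrow> ('a \<Rightarrow> real) set" where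
  "H1_0_surface S = {f \<in> H1_surface S. \<exists>g. is_surface_grad S f g \<and>
     (\<forall>e>0. \<exists>\<phi> D. C1_with_grad \<phi> D \<and> closure {x. \<phi> x \<noteq> 0} \<inter> surface_boundary S = {} \<and>
        L2_close (surface_measure S) e f \<phi> \<and>
        L2_close (surface_measure S) e g (tangential_part S D))}"

definition H1_surface_norm :: "(real ^ 'd) set \<Rightarrow> (real ^ 'd \<Rightarrow> real ^ 'd) \<Rightarrow> real" where
  "H1_surface_norm S w = sqrt ((L2_norm (surface_measure S) w)\<^sup>2 +
     (\<Sum>i\<in>UNIV. (L2_norm (surface_measure S) (surface_grad S (\<lambda>x. w x $ i)))\<^sup>2))"

definition simplicial_mesh :: "nat \<Rightarrow> 'a::euclidean_space set \<Rightarrow> 'a set set \<Rightarrow> bool" where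
  "simplicial_mesh m X \<T> \<longleftrightarrow>
     triangulation \<T> \<and> (\<forall>K\<in>\<T>. int m simplex K) \<and> \<Union>\<T> = X"

text \<open>The balls are taken relative to the affine hull, so that the definition also applies to the elements
  of a surface mesh.\<close>
definition inradius :: "'a::euclidean_space set \<Rightarrow> real" where
  "inradius K = Sup {r. 0 \<le> r \<and> (\<exists>x\<in>K. cball x r \<inter> affine hull K \<subseteq> K)}"

text \<open>Regularity and quasi-uniformity are properties of a family of meshes: the constant must not
  depend on the mesh.\<close>
definition regular_family :: "'a::euclidean_space set set set \<Rightarrow> bool" where
  "regular_family F \<longleftrightarrow> (\<exists>\<kappa>. \<forall>\<T>\<in>F. \<forall>K\<in>\<T>. diameter K \<le> \<kappa> * inradius K)"

definition mesh_size :: "'a::euclidean_space set set \<Rightarrow> real" where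
  "mesh_size \<T> = Max (diameter ` \<T>)"

definition quasi_uniform_family :: "'a::euclidean_space set set set \<Rightarrow> bool" where
  "quasi_uniform_family F \<longleftrightarrow> regular_family F \<and>
     (\<exists>\<kappa>. \<forall>\<T>\<in>F. \<forall>K\<in>\<T>. mesh_size \<T> \<le> \<kappa> * diameter K)"

definition P1_on :: "'a::real_vector set \<Rightarrow> ('a \<Rightarrow> 'b::real_vector) \<Rightarrow> bool" where
  "P1_on K v \<longleftrightarrow> (\<exists>l b. linear l \<and> (\<forall>x\<in>K. v x = l x + b))"

text \<open>\<open>thick\<close> is the thickness of the structure, \<open>stab\<close> the stabilization parameter, \<open>adm\<close> the space of
  admissible displacements and \<open>elas\<close> the elastic bilinear form.\<close>
record ('d::finite) fsi =
  fluid_dom :: "(real ^ 'd) set"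
  midsurf :: "(real ^ 'd) set"
  rho_f :: real
  visc :: real
  rho_s :: real
  thick :: real
  stab :: real
  adm :: "(real ^ 'd \<Rightarrow> real ^ 'd) set"
  elas :: "(real ^ 'd \<Rightarrow> real ^ 'd) \<Rightarrow> (real ^ 'd \<Rightarrow> real ^ 'd) \<Rightarrow> real"

definition function_subspace :: "('a \<Rightarrow> 'b::real_vector) set \<Rightarrow> bool" where
  "function_subspace X \<longleftrightarrow> (\<lambda>_. 0) \<in> X \<and> (\<forall>f\<in>X. \<forall>g\<in>X. (\<lambda>x. f x + g x) \<in> X) \<and>
     (\<forall>c. \<forall>f\<in>X. (\<lambda>x. c *\<^sub>R f x) \<in> X)"

definition sym_bilinear_on ::
  "('a \<Rightarrow> 'b::real_vector) set \<Rightarrow> (('a \<Rightarrow> 'b) \<Rightarrow> ('a \<Rightarrow> 'b) \<Rightarrow> real) \<Rightarrow> bool" where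
  "sym_bilinear_on X a \<longleftrightarrow>
     (\<forall>w\<in>X. \<forall>z\<in>X. a w z = a z w) \<and>
     (\<forall>w\<in>X. \<forall>w'\<in>X. \<forall>z\<in>X. a (\<lambda>x. w x + w' x) z = a w z + a w' z) \<and>
     (\<forall>c. \<forall>w\<in>X. \<forall>z\<in>X. a (\<lambda>x. c *\<^sub>R w x) z = c * a w z)"

definition fsi_problem :: "'d::finite fsi \<Rightarrow> bool" where
  "fsi_problem P \<longleftrightarrow>
     lipschitz_domain (fluid_dom P) \<and> bounded (fluid_dom P) \<and>
     lipschitz_surface (midsurf P) \<and>
     0 < rho_f P \<and> 0 < visc P \<and> 0 < rho_s P * thick P \<and> 0 < stab P \<and>
     function_subspace (adm P) \<and> adm P \<subseteq> componentwise (H1_0_surface (midsurf P)) \<and>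
     sym_bilinear_on (adm P) (elas P) \<and>
     (\<exists>C. \<forall>w\<in>adm P. \<forall>z\<in>adm P.
        \<bar>elas P w z\<bar> \<le> C * H1_surface_norm (midsurf P) w * H1_surface_norm (midsurf P) z) \<and>
     (\<exists>c>0. \<forall>w\<in>adm P. c * (H1_surface_norm (midsurf P) w)\<^sup>2 \<le> elas P w w)"

definition vol :: "'d::finite fsi \<Rightarrow> (real ^ 'd) measure" where
  "vol P = lebesgue_on (fluid_dom P)"

definition surf :: "'d::finite fsi \<Rightarrow> (real ^ 'd) measure" where
  "surf P = surface_measure (midsurf P)"

definition norm_s :: "'d::finite fsi \<Rightarrow> (real ^ 'd \<Rightarrow> real ^ 'd) \<Rightarrow> real" where
  "norm_s P w = sqrt (elas P w w)"

text \<open>Elements of \<open>V_space\<close>, \<open>Lambda_space\<close> and \<open>W_space\<close> are given by their continuous representative,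
  hence the condition on each closed simplex \<open>K\<close>. Elements of \<open>Q_space\<close> may jump across faces.\<close>
definition V_space :: "'d::finite fsi \<Rightarrow> (real ^ 'd) set set \<Rightarrow> (real ^ 'd \<Rightarrow> real ^ 'd) set" where
  "V_space P \<T> = {v \<in> componentwise (H1_0 (fluid_dom P)). \<forall>K\<in>\<T>. P1_on K v}"

definition Q_space :: "'d::finite fsi \<Rightarrow> (real ^ 'd) set set \<Rightarrow> (real ^ 'd \<Rightarrow> real) set" where
  "Q_space P \<T> = {q \<in> L2 (vol P). (LINT x|vol P. q x) = 0 \<and> (\<forall>K\<in>\<T>. P1_on (interior K) q)}"

definition W_space :: "'d::finite fsi \<Rightarrow> (real ^ 'd) set set \<Rightarrow> (real ^ 'd \<Rightarrow> real ^ 'd) set" where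
  "W_space P \<S> = {w \<in> adm P. \<forall>K\<in>\<S>. P1_on K w}"

definition Lambda_space :: "'d::finite fsi \<Rightarrow> (real ^ 'd) set set \<Rightarrow> (real ^ 'd \<Rightarrow> real ^ 'd) set" where
  "Lambda_space P \<S> = {l \<in> componentwise (H1_surface (midsurf P)). \<forall>K\<in>\<S>. P1_on K l}"

definition discrete_elastic_operator ::
  "'d::finite fsi \<Rightarrow> (real ^ 'd) set set \<Rightarrow> ((real ^ 'd \<Rightarrow> real ^ 'd) \<Rightarrow> (real ^ 'd \<Rightarrow> real ^ 'd)) \<Rightarrow> bool" where
  "discrete_elastic_operator P \<S> L \<longleftrightarrow>
     (\<forall>w\<in>adm P. L w \<in> W_space P \<S> \<and> (\<forall>z\<in>W_space P \<S>. L2_inner (surf P) (L w) z = elas P w z))"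

definition a_f :: "'d::finite fsi \<Rightarrow> (real ^ 'd \<Rightarrow> real ^ 'd) \<Rightarrow> (real ^ 'd \<Rightarrow> real) \<Rightarrow>
    (real ^ 'd \<Rightarrow> real ^ 'd) \<Rightarrow> (real ^ 'd \<Rightarrow> real) \<Rightarrow> real" where
  "a_f P u p v q =
     2 * visc P * L2_inner (vol P) (sym_grad (fluid_dom P) u) (sym_grad (fluid_dom P) v)
     - L2_inner (vol P) (weak_div (fluid_dom P) v) p
     + L2_inner (vol P) (weak_div (fluid_dom P) u) q"

definition b_form :: "'d::finite fsi \<Rightarrow> (real ^ 'd \<Rightarrow> real ^ 'd) \<Rightarrow> (real ^ 'd \<Rightarrow> real ^ 'd) \<Rightarrow>
    (real ^ 'd \<Rightarrow> real ^ 'd) \<Rightarrow> real" where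
  "b_form P z u v = rho_f P / 2 *
     (L2_inner (vol P) (\<lambda>x. weak_jac (fluid_dom P) u x *v z x) v
      - L2_inner (vol P) (\<lambda>x. weak_jac (fluid_dom P) v x *v z x) u)"

text \<open>The duality pairing of \<open>(H\<^sup>1\<^sup>/\<^sup>2)'\<close> and \<open>H\<^sup>1\<^sup>/\<^sup>2\<close>, for a first argument in \<open>L\<^sup>2\<close>, which is identified
  with the functional that it induces.\<close>
definition c_form :: "'d::finite fsi \<Rightarrow> (real ^ 'd \<Rightarrow> real ^ 'd) \<Rightarrow> (real ^ 'd \<Rightarrow> real ^ 'd) \<Rightarrow> real" where
  "c_form P l w = L2_inner (surf P) l w"

definition s_form :: "'d::finite fsi \<Rightarrow> (real ^ 'd) set set \<Rightarrow> (real ^ 'd \<Rightarrow> real) \<Rightarrow>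
    (real ^ 'd \<Rightarrow> real) \<Rightarrow> real" where
  "s_form P \<T> p q = stab P * (\<Sum>K\<in>\<T>. (diameter K)\<^sup>2 *
     L2_inner (lebesgue_on (interior K)) (weak_grad (interior K) p) (weak_grad (interior K) q))"

definition seminorm_sh :: "'d::finite fsi \<Rightarrow> (real ^ 'd) set set \<Rightarrow> (real ^ 'd \<Rightarrow> real) \<Rightarrow> real" where
  "seminorm_sh P \<T> q = sqrt (s_form P \<T> q q)"

definition a_fh :: "'d::finite fsi \<Rightarrow> (real ^ 'd) set set \<Rightarrow> (real ^ 'd \<Rightarrow> real ^ 'd) \<Rightarrow>
    (real ^ 'd \<Rightarrow> real) \<Rightarrow> (real ^ 'd \<Rightarrow> real ^ 'd) \<Rightarrow> (real ^ 'd \<Rightarrow> real) \<Rightarrow> real" where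
  "a_fh P \<T> u p v q = a_f P u p v q + s_form P \<T> p q"

definition diff_quot :: "real \<Rightarrow> (nat \<Rightarrow> 'a \<Rightarrow> 'b::real_vector) \<Rightarrow> nat \<Rightarrow> 'a \<Rightarrow> 'b" where
  "diff_quot \<tau> g n = (\<lambda>x. (g n x - g (n - 1) x) /\<^sub>R \<tau>)"

definition extrapolated ::
  "nat \<Rightarrow> real \<Rightarrow> (nat \<Rightarrow> 'a \<Rightarrow> 'b::real_vector) \<Rightarrow> (nat \<Rightarrow> 'a \<Rightarrow> 'b) \<Rightarrow> nat \<Rightarrow> 'a \<Rightarrow> 'b" where
  "extrapolated r \<tau> d d' n =
     (if r = 1 then d (n - 1) else (\<lambda>x. d (n - 1) x + \<tau> *\<^sub>R d' (n - 1) x))"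

text \<open>In the following, \<open>d'\<close> is the structure velocity and \<open>dh n\<close> is the intermediate velocity with
  index \<open>n - 1/2\<close>.\<close>
definition splitting_step1 where
  "splitting_step1 (P :: 'd::finite fsi) \<T> \<S> r \<tau> u p l dh d d' \<phi> n \<longleftrightarrow>
     u n \<in> V_space P \<T> \<and> p n \<in> Q_space P \<T> \<and> l n \<in> Lambda_space P \<S> \<and> dh n \<in> W_space P \<S> \<and>
     (\<forall>v\<in>V_space P \<T>. \<forall>q\<in>Q_space P \<T>. \<forall>m\<in>Lambda_space P \<S>.
        rho_f P * L2_inner (vol P) (diff_quot \<tau> u n) v + b_form P (u (n - 1)) (u n) v
        + a_fh P \<T> (u n) (p n) v q
        + c_form P (l n) (v \<circ> \<phi> (n - 1))
        - c_form P m (\<lambda>x. u n (\<phi> (n - 1) x) - dh n x) = 0) \<and>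
     (\<forall>w\<in>W_space P \<S>.
        rho_s P * thick P / \<tau> * L2_inner (surf P) (\<lambda>x. dh n x - d' (n - 1) x) w
        = c_form P (l n) w - elas P (extrapolated r \<tau> d d' n) w)"

definition splitting_step2 where
  "splitting_step2 (P :: 'd::finite fsi) \<S> \<tau> l d d' n \<longleftrightarrow>
     d n \<in> W_space P \<S> \<and> d' n \<in> W_space P \<S> \<and>
     (\<forall>w\<in>W_space P \<S>.
        rho_s P * thick P * L2_inner (surf P) (diff_quot \<tau> d' n) w + elas P (d n) w = c_form P (l n) w) \<and>
     (\<forall>x\<in>midsurf P. d' n x = diff_quot \<tau> d n x)"

definition splitting_step3 where
  "splitting_step3 (P :: 'd::finite fsi) d \<phi> n \<longleftrightarrow> (\<forall>x\<in>midsurf P. \<phi> n x = x + d n x)"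

definition splitting_algorithm where
  "splitting_algorithm (P :: 'd::finite fsi) \<T> \<S> r \<tau> N u0 d0 d1 \<phi>0 u p l dh d d' \<phi> \<longleftrightarrow>
     u 0 = u0 \<and> d 0 = d0 \<and> d' 0 = d1 \<and> \<phi> 0 = \<phi>0 \<and>
     (\<forall>n\<in>{1..N}.
        splitting_step1 P \<T> \<S> r \<tau> u p l dh d d' \<phi> n \<and>
        splitting_step2 P \<S> \<tau> l d d' n \<and>
        splitting_step3 P d \<phi> n)"

definition energy :: "'d::finite fsi \<Rightarrow> (real ^ 'd \<Rightarrow> real ^ 'd) \<Rightarrow> (real ^ 'd \<Rightarrow> real ^ 'd) \<Rightarrow>
    (real ^ 'd \<Rightarrow> real ^ 'd) \<Rightarrow> real" where
  "energy P u d' d = rho_f P * (L2_norm (vol P) u)\<^sup>2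
     + rho_s P * thick P * (L2_norm (surf P) d')\<^sup>2 + (norm_s P d)\<^sup>2"

definition dissipation :: "'d::finite fsi \<Rightarrow> (real ^ 'd) set set \<Rightarrow> real \<Rightarrow>
    (nat \<Rightarrow> real ^ 'd \<Rightarrow> real ^ 'd) \<Rightarrow> (nat \<Rightarrow> real ^ 'd \<Rightarrow> real) \<Rightarrow> nat \<Rightarrow> real" where
  "dissipation P \<T> \<tau> u p n = (\<Sum>m=1..n. \<tau> *
     (4 * visc P * (L2_norm (vol P) (sym_grad (fluid_dom P) (u m)))\<^sup>2
      + 2 * (seminorm_sh P \<T> (p m))\<^sup>2))"

end

theory Submission
  imports Defs
begin

text \<open>Why the theorem holds. Write \<open>k\<close> for the surface density of the structure, \<open>v\<^sub>n\<close> for the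
  structure velocity, \<open>vh\<close> for the intermediate velocity, and \<open>e\<close> for the extrapolated displacement.

  Testing the fluid equations with the discrete solution itself makes the convection term and the
  coupling of velocity and pressure cancel and leaves the work of the interface force on the fluid. The kinematic constraint, tested with the
  multiplier, replaces the fluid velocity by \<open>vh\<close> in this work (\<open>fluid_energy_balance\<close>). On the structure
  side, the difference of the two steps reads \<open>k (v\<^sub>n - vh) = - \<tau> L (d\<^sub>n - e)\<close>. Inserting this expression for
  \<open>vh\<close> into the second step tested with \<open>vh\<close> gives the usual backward Euler energy increment plus two
  splitting terms,
  \<open>2 \<tau> a(d\<^sub>n - e, v\<^sub>n - v\<^sub>n\<^sub>-\<^sub>1)\<close> and \<open>(2 \<tau>\<^sup>2 / k) a(d\<^sub>n - e, L d\<^sub>n)\<close> (\<open>structure_energy_identity\<close>).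

  For \<open>r = 1\<close>, \<open>d\<^sub>n - e = d\<^sub>n - d\<^sub>n\<^sub>-\<^sub>1 = \<tau> v\<^sub>n\<close>, and both terms have the form \<open>2 B(x - y, x)\<close>, which is at least
  \<open>B(x, x) - B(y, y)\<close>: they telescope and give the two extra terms of the estimate
  (\<open>first_order_stability\<close>). For \<open>r = 2\<close>, \<open>d\<^sub>n - e = \<tau> (v\<^sub>n - v\<^sub>n\<^sub>-\<^sub>1)\<close>. The first term is now a nonnegative
  square that absorbs the second one up to \<open>(\<tau>\<^sup>4 / (2 k\<^sup>2)) a(L d\<^sub>n, L d\<^sub>n)\<close>. By the inverse inequality
  and the restriction on \<open>\<tau>\<close> this remainder is at most a multiple of \<open>\<tau> \<alpha>\<^sup>3\<close> times the elastic energy, and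
  a discrete Gronwall argument concludes (\<open>second_order_stability\<close>).

  The algebra requires the interface integrals to be additive, hence the products of the finite element functions
  to be integrable on the surface. These functions are continuous on the compact mid-surface,
  so it suffices that its Hausdorff measure is finite; this follows from the
  triangulation (\<open>finite_measure_surface_measure\<close>).\<close>

section \<open>The Hausdorff measure of a triangulated surface is finite\<close>

text \<open>Dividing each of the \<open>s\<close> edges into \<open>k\<close> equal parts yields \<open>k ^ s\<close> cells of diameter at most \<open>l / k\<close>,
  where \<open>l\<close> is the sum of the edge lengths. The factor \<open>k ^ s\<close> cancels in the sum over the cells, so
  the bound does not depend on \<open>\<delta>\<close>.\<close>
lemma hausdorff_content_parallelotope:
  fixes a :: "'i \<Rightarrow> 'a::euclidean_space"
  assumes "finite I" "card I = s" "s \<ge> 1" "\<delta> > 0"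
  shows "hausdorff_content s \<delta> {x0 + (\<Sum>i\<in>I. t i *\<^sub>R a i) |t. \<forall>i\<in>I. 0 \<le> t i \<and> t i \<le> 1}
           \<le> ennreal (unit_ball_vol (real s) * ((\<Sum>i\<in>I. norm (a i)) / 2) ^ s)"
proof -
  define l where "l = (\<Sum>i\<in>I. norm (a i))"
  have l0: "l \<ge> 0" unfolding l_def by (simp add: sum_nonneg)
  obtain k :: nat where k: "l / \<delta> < real k" "k > 0"
    by (metis reals_Archimedean2 gr0I l0 assms(4) divide_nonneg_pos of_nat_0 not_less)
  have lk: "l / k \<le> \<delta>" using k assms(4) by (simp add: field_simps less_imp_le)
  define J where "J = (PiE I (\<lambda>_. {..<k}))"
  have J: "finite J" "card J = k ^ s" unfolding J_def using assms(1,2)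
    by (simp_all add: card_PiE finite_PiE)
  obtain g where g: "bij_betw g {0..<k ^ s} J" using ex_bij_betw_nat_finite[OF J(1)] J(2) by metis
  \<comment> \<open>The cover is a sequence: beyond the cells it continues with empty sets, which contribute
      \<open>0 ^ s = 0\<close> because \<open>s \<ge> 1\<close>.\<close>
  define C where "C n = (if n < k ^ s then
      {x0 + (\<Sum>i\<in>I. t i *\<^sub>R a i) |t. \<forall>i\<in>I. real (g n i) / k \<le> t i \<and> t i \<le> (real (g n i) + 1) / k}
      else {})" for n
  have dist: "norm (x - y) \<le> l / k" if xy: "x \<in> C n" "y \<in> C n" for x y n
  proof -
    obtain t u where tu: "x = x0 + (\<Sum>i\<in>I. t i *\<^sub>R a i)" "y = x0 + (\<Sum>i\<in>I. u i *\<^sub>R a i)"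
      and b: "\<forall>i\<in>I. real (g n i) / k \<le> t i \<and> t i \<le> (real (g n i) + 1) / k"
        "\<forall>i\<in>I. real (g n i) / k \<le> u i \<and> u i \<le> (real (g n i) + 1) / k"
      using xy unfolding C_def by (auto split: if_splits)
    have "norm (x - y) = norm (\<Sum>i\<in>I. (t i - u i) *\<^sub>R a i)"
      unfolding tu by (simp add: sum_subtractf scaleR_left_diff_distrib)
    also have "\<dots> \<le> (\<Sum>i\<in>I. \<bar>t i - u i\<bar> * norm (a i))"
      using norm_sum[of "\<lambda>i. (t i - u i) *\<^sub>R a i" I] by simp
    also have "\<dots> \<le> (\<Sum>i\<in>I. (1 / k) * norm (a i))"
    proof (intro sum_mono mult_right_mono)
      fix i assume "i \<in> I"
      then show "\<bar>t i - u i\<bar> \<le> 1 / k" using b by (fastforce simp: add_divide_distrib abs_le_iff)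
    qed simp
    also have "\<dots> = l / k" unfolding l_def by (simp add: sum_divide_distrib)
    finally show ?thesis .
  qed
  have diam: "diameter (C n) \<le> l / k" for n
    using l0 dist by (intro diameter_le) auto
  have bdd: "bounded (C n)" for n
    unfolding bounded_two_points using dist by (auto simp: dist_norm)
  have cov: "{x0 + (\<Sum>i\<in>I. t i *\<^sub>R a i) |t. \<forall>i\<in>I. 0 \<le> t i \<and> t i \<le> 1} \<subseteq> (\<Union>n. C n)"
  proof clarify
    fix t assume t: "\<forall>i\<in>I. 0 \<le> t i \<and> t i \<le> (1::real)"
    \<comment> \<open>The minimum puts the end point \<open>t i = 1\<close> into the last cell.\<close>
    define j where "j = (\<lambda>i\<in>I. min (nat \<lfloor>k * t i\<rfloor>) (k - 1))"
    have "j \<in> J" unfolding J_def j_def using k by auto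
    then obtain n where n: "n < k ^ s" "g n = j"
      using bij_betw_imp_surj_on[OF g] by (metis atLeastLessThan_iff imageE)
    have "real (j i) / k \<le> t i \<and> t i \<le> (real (j i) + 1) / k" if "i \<in> I" for i
    proof -
      have ti: "0 \<le> t i" "t i \<le> 1" using t that by auto
      define f where "f = nat \<lfloor>k * t i\<rfloor>"
      have f: "real f \<le> k * t i" "k * t i < real f + 1" 
        unfolding f_def using ti by (auto simp: of_nat_floor) 
      have kt: "k * t i \<le> k" using ti by (simp add: mult_left_le)
      have ji: "real (j i) = (if f \<le> k - 1 then real f else real k - 1)"
        using that k by (simp add: j_def f_def of_nat_diff)
      have "real k - 1 < real f" if "\<not> f \<le> k - 1" using that k by linarith
      then have "real (j i) \<le> k * t i" "k * t i \<le> real (j i) + 1"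
        using f kt unfolding ji by (simp_all split: if_splits) linarith+
      then show ?thesis using k by (simp add: field_simps)
    qed
    then have "x0 + (\<Sum>i\<in>I. t i *\<^sub>R a i) \<in> C n" using n unfolding C_def by auto
    then show "x0 + (\<Sum>i\<in>I. t i *\<^sub>R a i) \<in> (\<Union>n. C n)" by blast
  qed
  have "(\<Sum>n. ennreal (unit_ball_vol (real s) * (diameter (C n) / 2) ^ s))
      = (\<Sum>n<k ^ s. ennreal (unit_ball_vol (real s) * (diameter (C n) / 2) ^ s))"
    using assms(3) by (intro suminf_finite) (auto simp: C_def)
  also have "\<dots> \<le> (\<Sum>n<k ^ s. ennreal (unit_ball_vol (real s) * (l / k / 2) ^ s))"
    by (intro sum_mono ennreal_leI mult_left_mono power_mono divide_right_mono diam)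
       (auto intro!: diameter_ge_0 bdd)
  also have "\<dots> = ennreal (unit_ball_vol (real s) * (l / 2) ^ s)"
    using k l0 by (simp add: ennreal_of_nat_eq_real_of_nat ennreal_mult'[symmetric] power_divide)
  finally have sum: "(\<Sum>n. ennreal (unit_ball_vol (real s) * (diameter (C n) / 2) ^ s))
      \<le> ennreal (unit_ball_vol (real s) * (l / 2) ^ s)" .
  have "diameter (C n) \<le> \<delta>" for n using diam lk by (rule order_trans)
  then show ?thesis
    unfolding hausdorff_content_def l_def[symmetric]
    using cov bdd sum by (intro INF_lower2[where i = C]) blast+
qed

text \<open>The edges at a vertex \<open>c\<close> span the parallelotope; barycentric coordinates lie in \<open>[0, 1]\<close>.\<close>
lemma simplex_subset_parallelotope:
  fixes K :: "'a::euclidean_space set"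
  assumes "int m simplex K"
  obtains c V where "finite V" "card V = m"
    "K \<subseteq> {c + (\<Sum>v\<in>V. t v *\<^sub>R (v - c)) |t. \<forall>v\<in>V. 0 \<le> t v \<and> t v \<le> 1}"
proof -
  obtain C where C: "card C = m + 1" "K = convex hull C" "finite C"
    using assms unfolding simplex_def by (metis aff_independent_finite int_ops(2) of_nat_add of_nat_eq_iff)
  then obtain c V where V: "C = insert c V" "c \<notin> V" "card V = m" "finite V"
    by (metis Suc_eq_plus1 card_Suc_eq finite_insert)
  show ?thesis
  proof (rule that[OF V(4,3)], rule subsetI)
    fix x assume "x \<in> K"
    then obtain t where t: "\<forall>v\<in>C. 0 \<le> t v" "sum t C = 1" "x = (\<Sum>v\<in>C. t v *\<^sub>R v)"
      unfolding C convex_hull_finite[OF C(3)] by auto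
    have tc: "t c = 1 - sum t V" using t V by simp
    have "x = t c *\<^sub>R c + (\<Sum>v\<in>V. t v *\<^sub>R v)" using t V by simp
    then have "x = c + (\<Sum>v\<in>V. t v *\<^sub>R (v - c))"
      unfolding tc by (simp add: algebra_simps sum_subtractf flip: scaleR_left.sum)
    moreover have "t v \<le> 1" if "v \<in> V" for v
      using t V C that member_le_sum[of v C t] by auto
    ultimately show "x \<in> {c + (\<Sum>v\<in>V. t v *\<^sub>R (v - c)) |t. \<forall>v\<in>V. 0 \<le> t v \<and> t v \<le> 1}"
      using t V by auto
  qed
qed

lemma sets_hausdorff_measure [measurable_cong]: "sets (hausdorff_measure s) = sets borel"
  unfolding hausdorff_measure_def using sets.sets_measure_of_eq[of borel] by simp

text \<open>A measure given by \<open>measure_of\<close> is either the prescribed set function or zero, so that in both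
  cases the uniform bound on the contents bounds the measure.\<close>
lemma hausdorff_measure_simplex_finite:
  fixes K :: "'a::euclidean_space set"
  assumes "int m simplex K" "m \<ge> 1"
  shows "emeasure (hausdorff_measure m) K < \<infinity>"
proof -
  obtain c V where V: "finite V" "card V = m"
    "K \<subseteq> {c + (\<Sum>v\<in>V. t v *\<^sub>R (v - c)) |t. \<forall>v\<in>V. 0 \<le> t v \<and> t v \<le> 1}"
    using simplex_subset_parallelotope[OF assms(1)] by blast
  have "hausdorff_content m \<delta> K \<le> ennreal (unit_ball_vol (real m) * ((\<Sum>v\<in>V. norm (v - c)) / 2) ^ m)"
    if "\<delta> > 0" for \<delta>
  proof -
    have "hausdorff_content m \<delta> K
        \<le> hausdorff_content m \<delta> {c + (\<Sum>v\<in>V. t v *\<^sub>R (v - c)) |t. \<forall>v\<in>V. 0 \<le> t v \<and> t v \<le> 1}"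
      unfolding hausdorff_content_def
      by (intro INF_superset_mono order_refl) (use V(3) in \<open>auto intro: order_trans\<close>)
    also note hausdorff_content_parallelotope[OF V(1,2) assms(2) that]
    finally show ?thesis .
  qed
  then have "(SUP \<delta>\<in>{0<..}. hausdorff_content m \<delta> K)
      \<le> ennreal (unit_ball_vol (real m) * ((\<Sum>v\<in>V. norm (v - c)) / 2) ^ m)"
    by (intro SUP_least) auto
  then have "emeasure (hausdorff_measure m) K
      \<le> ennreal (unit_ball_vol (real m) * ((\<Sum>v\<in>V. norm (v - c)) / 2) ^ m)"
    unfolding hausdorff_measure_def emeasure_measure_of_conv by auto
  then show ?thesis using ennreal_less_top le_less_trans by fastforce
qed

lemma simplicial_meshD:
  assumes "simplicial_mesh m X \<T>"
  shows "finite \<T>" "\<Union>\<T> = X" "K \<in> \<T> \<Longrightarrow> int m simplex K" "K \<in> \<T> \<Longrightarrow> compact K"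
  using assms unfolding simplicial_mesh_def triangulation_def by (auto intro: compact_simplex)

lemma finite_measure_surface_measure:
  fixes S :: "'a::euclidean_space set"
  assumes "simplicial_mesh (DIM('a) - 1) S \<S>" "DIM('a) \<ge> 2"
  shows "finite_measure (surface_measure S)"
proof -
  let ?H = "hausdorff_measure (DIM('a) - 1) :: 'a measure"
  note mesh = simplicial_meshD[OF assms(1)]
  have borel: "K \<in> sets ?H" if "K \<in> \<S>" for K
    using mesh(4)[OF that] by (simp add: sets_hausdorff_measure borel_compact)
  have "\<S> \<subseteq> sets ?H" using borel by blast
  then have "S \<in> sets ?H" using sets.finite_Union[OF mesh(1)] mesh(2) by metis
  then have "emeasure (surface_measure S) (space (surface_measure S)) = emeasure ?H S"
    unfolding surface_measure_def
    by (simp add: emeasure_restrict_space space_restrict_space sets.Int_space_eq1)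
  also have "\<dots> \<le> (\<Sum>K\<in>\<S>. emeasure ?H K)"
    using emeasure_subadditive_finite[OF mesh(1), of "\<lambda>K. K" ?H] borel mesh(2) by auto
  also have "\<dots> < \<infinity>"
    using hausdorff_measure_simplex_finite[OF mesh(3)] assms(2) by (simp add: mesh(1))
  finally show ?thesis by (intro finite_measureI) auto
qed

section \<open>Finite element functions are square integrable\<close>
lemma continuous_on_P1_mesh:
  fixes v :: "'a::euclidean_space \<Rightarrow> 'b::euclidean_space"
  assumes "simplicial_mesh m X \<T>" "\<And>K. K \<in> \<T> \<Longrightarrow> P1_on K v"
  shows "continuous_on X v"
proof -
  note mesh = simplicial_meshD[OF assms(1)]
  have "continuous_on K v" if K: "K \<in> \<T>" for K
  proof -
    obtain l b where l: "linear l" "\<forall>x\<in>K. v x = l x + b"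
      using assms(2)[OF K] unfolding P1_on_def by metis
    have "continuous_on K (\<lambda>x. l x + b)"
      using l(1) by (intro continuous_on_add continuous_on_const linear_continuous_on)
        (simp add: linear_conv_bounded_linear)
    then show ?thesis using l(2) by (simp cong: continuous_on_cong)
  qed
  then have "continuous_on (\<Union>K\<in>\<T>. K) v"
    by (intro continuous_on_closed_Union) (auto simp: mesh compact_imp_closed)
  then show ?thesis using mesh(2) by simp
qed

lemma (in finite_measure) bounded_measurable_in_L2:
  fixes f :: "'a \<Rightarrow> 'b::euclidean_space"
  assumes "f \<in> borel_measurable M" "bounded (f ` space M)"
  shows "f \<in> L2 M"
proof -
  obtain B where B: "\<forall>x\<in>space M. norm (f x) \<le> B" using assms(2) unfolding bounded_iff by auto
  have "integrable M (\<lambda>x. (norm (f x))\<^sup>2)"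
    using B assms(1) by (intro integrable_const_bound[of _ "B\<^sup>2"]) (auto intro!: AE_I2 power_mono)
  then show ?thesis using assms(1) unfolding L2_def by simp
qed

lemma continuous_on_in_L2_surface:
  fixes f :: "'a::euclidean_space \<Rightarrow> 'b::euclidean_space"
  assumes "finite_measure (surface_measure S)" "compact S" "continuous_on S f"
  shows "f \<in> L2 (surface_measure S)"
proof (rule finite_measure.bounded_measurable_in_L2[OF assms(1)])
  have "sets (surface_measure S) = sets (restrict_space borel S)"
    unfolding surface_measure_def by (intro sets_restrict_space_cong sets_hausdorff_measure)
  then show "f \<in> borel_measurable (surface_measure S)"
    using borel_measurable_continuous_on_restrict[OF assms(3)] measurable_cong_sets by blast
  have "space (surface_measure S) \<subseteq> S" unfolding surface_measure_def space_restrict_space by auto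
  then show "bounded (f ` space (surface_measure S))"
    by (intro bounded_subset[OF compact_imp_bounded[OF compact_continuous_image[OF assms(3,2)]]] image_mono)
qed

lemma continuous_on_in_L2_lebesgue_on:
  fixes f :: "'a::euclidean_space \<Rightarrow> 'b::euclidean_space"
  assumes "open U" "bounded U" "continuous_on (closure U) f"
  shows "f \<in> L2 (lebesgue_on U)"
proof (rule finite_measure.bounded_measurable_in_L2)
  have U: "U \<in> lmeasurable" using assms by (simp add: lmeasurable_open)
  then show "finite_measure (lebesgue_on U)" by (rule finite_measure_lebesgue_on)
  show "f \<in> borel_measurable (lebesgue_on U)"
    using U assms(3) by (intro continuous_imp_measurable_on_sets_lebesgue)
      (auto intro: continuous_on_subset[OF _ closure_subset] fmeasurableD)
  have "f ` space (lebesgue_on U) \<subseteq> f ` closure U" using closure_subset by auto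
  then show "bounded (f ` space (lebesgue_on U))"
    using compact_imp_bounded[OF compact_continuous_image[OF assms(3)]] assms(2) bounded_subset
    by (metis compact_closure)
qed

lemma L2_integrable_inner:
  assumes "f \<in> L2 M" "g \<in> L2 M"
  shows "integrable M (\<lambda>x. f x \<bullet> g x)"
proof (rule Bochner_Integration.integrable_bound)
  show "integrable M (\<lambda>x. (norm (f x))\<^sup>2 + (norm (g x))\<^sup>2)" using assms unfolding L2_def by auto
  show "(\<lambda>x. f x \<bullet> g x) \<in> borel_measurable M" using assms unfolding L2_def by auto
  have "\<bar>f x \<bullet> g x\<bar> \<le> (norm (f x))\<^sup>2 + (norm (g x))\<^sup>2" for x
  proof -
    have "\<bar>f x \<bullet> g x\<bar> \<le> norm (f x) * norm (g x)" by (rule Cauchy_Schwarz_ineq2)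
    also have "\<dots> \<le> (norm (f x))\<^sup>2 + (norm (g x))\<^sup>2"
      using sum_squares_bound[of "norm (f x)" "norm (g x)"] zero_le_power2[of "norm (f x)"]
        zero_le_power2[of "norm (g x)"] by linarith
    finally show ?thesis .
  qed
  then show "AE x in M. norm (f x \<bullet> g x) \<le> norm ((norm (f x))\<^sup>2 + (norm (g x))\<^sup>2)" by simp
qed

lemma function_subspace_L2: "function_subspace (L2 M)"
  unfolding function_subspace_def
proof (intro conjI ballI allI)
  show "(\<lambda>_. 0) \<in> L2 M" by (simp add: L2_def)
next
  fix f g :: "'a \<Rightarrow> 'b" assume fg: "f \<in> L2 M" "g \<in> L2 M"
  have "integrable M (\<lambda>x. f x \<bullet> f x + 2 * (f x \<bullet> g x) + g x \<bullet> g x)"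
    by (intro Bochner_Integration.integrable_add integrable_mult_right L2_integrable_inner fg)
  moreover have "(norm (f x + g x))\<^sup>2 = f x \<bullet> f x + 2 * (f x \<bullet> g x) + g x \<bullet> g x" for x
    by (simp add: power2_norm_eq_inner inner_simps inner_commute)
  ultimately show "(\<lambda>x. f x + g x) \<in> L2 M" using fg unfolding L2_def by (auto intro: borel_measurable_add)
next
  fix c :: real and f assume "f \<in> L2 M"
  then show "(\<lambda>x. c *\<^sub>R f x) \<in> L2 M" unfolding L2_def by (auto simp: power_mult_distrib)
qed

lemma sym_bilinear_on_L2: "sym_bilinear_on (L2 M) (L2_inner M)"
  unfolding sym_bilinear_on_def L2_inner_def
  by (intro conjI ballI allI)
     (simp_all add: inner_add_left L2_integrable_inner, simp only: inner_commute)

lemma L2_norm_power2: "(L2_norm M f)\<^sup>2 = L2_inner M f f"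
  unfolding L2_norm_def by (simp add: L2_inner_def)

section \<open>Symmetric bilinear forms\<close>
lemma function_subspace_add:
  "function_subspace X \<Longrightarrow> f \<in> X \<Longrightarrow> g \<in> X \<Longrightarrow> (\<lambda>x. f x + g x) \<in> X"
  unfolding function_subspace_def by simp

lemma function_subspace_scale:
  "function_subspace X \<Longrightarrow> f \<in> X \<Longrightarrow> (\<lambda>x. c *\<^sub>R f x) \<in> X"
  unfolding function_subspace_def by simp

lemma function_subspace_diff:
  assumes "function_subspace X" "f \<in> X" "g \<in> X"
  shows "(\<lambda>x. f x - g x) \<in> X"
proof -
  have "(\<lambda>x. f x + (-1) *\<^sub>R g x) \<in> X"
    by (intro function_subspace_add function_subspace_scale assms)
  then show ?thesis by simp
qed

lemma form_commute: "sym_bilinear_on X B \<Longrightarrow> w \<in> X \<Longrightarrow> z \<in> X \<Longrightarrow> B w z = B z w"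
  unfolding sym_bilinear_on_def by blast

lemma form_add_left:
  "sym_bilinear_on X B \<Longrightarrow> w \<in> X \<Longrightarrow> w' \<in> X \<Longrightarrow> z \<in> X \<Longrightarrow> B (\<lambda>x. w x + w' x) z = B w z + B w' z"
  unfolding sym_bilinear_on_def by blast

lemma form_scale_left:
  "sym_bilinear_on X B \<Longrightarrow> w \<in> X \<Longrightarrow> z \<in> X \<Longrightarrow> B (\<lambda>x. c *\<^sub>R w x) z = c * B w z"
  unfolding sym_bilinear_on_def by blast

lemma form_diff_left:
  assumes "function_subspace X" "sym_bilinear_on X B" "w \<in> X" "w' \<in> X" "z \<in> X"
  shows "B (\<lambda>x. w x - w' x) z = B w z - B w' z"
proof -
  have "(\<lambda>x. (-1) *\<^sub>R w' x) \<in> X" by (intro function_subspace_scale assms(1,4))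
  then show ?thesis
    using form_add_left[OF assms(2,3) _ assms(5), of "\<lambda>x. (-1) *\<^sub>R w' x"]
      form_scale_left[OF assms(2,4,5), of "-1"]
    by simp
qed

lemma form_diff_right:
  assumes "function_subspace X" "sym_bilinear_on X B" "w \<in> X" "w' \<in> X" "z \<in> X"
  shows "B z (\<lambda>x. w x - w' x) = B z w - B z w'"
  using form_diff_left[OF assms] form_commute[OF assms(2)] assms(3-5)
    function_subspace_diff[OF assms(1,3,4)] by metis

text \<open>The source of all telescoping sums below.\<close>
lemma form_polarization:
  assumes "function_subspace X" "sym_bilinear_on X B" "w \<in> X" "z \<in> X"
  shows "2 * B (\<lambda>x. w x - z x) w = B w w - B z z + B (\<lambda>x. w x - z x) (\<lambda>x. w x - z x)"
  using assms(3,4) function_subspace_diff[OF assms(1,3,4)]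
  by (simp add: form_diff_left[OF assms(1,2)] form_diff_right[OF assms(1,2)]
      form_commute[OF assms(2), of z w])

lemma form_square_expand:
  assumes "function_subspace X" "sym_bilinear_on X B" "w \<in> X" "z \<in> X"
  shows "B (\<lambda>x. w x + c *\<^sub>R z x) (\<lambda>x. w x + c *\<^sub>R z x) = B w w + 2 * c * B w z + c\<^sup>2 * B z z"
proof -
  let ?s = "\<lambda>x. w x + c *\<^sub>R z x"
  have cz: "(\<lambda>x. c *\<^sub>R z x) \<in> X" by (intro function_subspace_scale assms)
  then have s: "?s \<in> X" by (intro function_subspace_add assms)
  have "B ?s y = B w y + c * B z y" if "y \<in> X" for y
    using that assms cz by (simp add: form_add_left[OF assms(2)] form_scale_left[OF assms(2)])
  then show ?thesis
    using assms s form_commute[OF assms(2), of w ?s] form_commute[OF assms(2), of z ?s]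
      form_commute[OF assms(2), of z w]
    by (simp add: power2_eq_square algebra_simps)
qed

section \<open>The work of the interface force on the structure\<close>

text \<open>Here \<open>F\<close> is the interface force, \<open>m\<close> the \<open>L\<^sup>2\<close> product on the surface, \<open>e\<close> the extrapolated displacement
  and \<open>Ld\<close> the Riesz representative of \<open>a d\<close>. Subtracting the two equations, which have the same force, expresses
  the correction \<open>v - vh\<close> through \<open>d - e\<close>. This is needed twice: tested with \<open>v - v\<^sub>0\<close> it
  handles the inertia, and tested with \<open>Ld\<close> the elastic power \<open>a d vh\<close>, which turns into
  an \<open>m\<close> product by the definition of \<open>Ld\<close>.\<close>
lemma structure_energy_identity:
  fixes W :: "('a \<Rightarrow> 'b::real_vector) set"
  assumes W: "function_subspace W" and m: "sym_bilinear_on W m" and a: "sym_bilinear_on W a"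
    and "k > 0" "\<tau> > 0"
    and mem: "d \<in> W" "d\<^sub>0 \<in> W" "v \<in> W" "v\<^sub>0 \<in> W" "vh \<in> W" "e \<in> W" "Ld \<in> W"
    and predictor: "\<And>w. w \<in> W \<Longrightarrow> k / \<tau> * m (\<lambda>x. vh x - v\<^sub>0 x) w = F w - a e w"
    and corrector: "\<And>w. w \<in> W \<Longrightarrow> k / \<tau> * m (\<lambda>x. v x - v\<^sub>0 x) w + a d w = F w"
    and velocity: "v = (\<lambda>x. (d x - d\<^sub>0 x) /\<^sub>R \<tau>)"
    and Ld: "\<And>w. w \<in> W \<Longrightarrow> m Ld w = a d w"
  shows "2 * \<tau> * F vh =
      k * (m v v - m v\<^sub>0 v\<^sub>0 + m (\<lambda>x. v x - v\<^sub>0 x) (\<lambda>x. v x - v\<^sub>0 x))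
      + (a d d - a d\<^sub>0 d\<^sub>0 + a (\<lambda>x. d x - d\<^sub>0 x) (\<lambda>x. d x - d\<^sub>0 x))
      + 2 * \<tau> * a (\<lambda>x. d x - e x) (\<lambda>x. v x - v\<^sub>0 x)
      + 2 * \<tau>\<^sup>2 / k * a (\<lambda>x. d x - e x) Ld"
proof -
  let ?dv = "\<lambda>x. v x - v\<^sub>0 x" and ?de = "\<lambda>x. d x - e x" and ?dd = "\<lambda>x. d x - d\<^sub>0 x"
  have diffs: "?dv \<in> W" "?dd \<in> W" using mem by (auto intro: function_subspace_diff[OF W])
  have correction: "k * m vh w = k * m v w + \<tau> * a ?de w" if "w \<in> W" for w
    using predictor[OF that] corrector[OF that] that mem \<open>\<tau> > 0\<close>
    by (simp add: form_diff_left[OF W m] form_diff_left[OF W a] field_simps)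
  have "k * m ?dv vh = k * m ?dv v + \<tau> * a ?de ?dv"
    using correction[OF diffs(1)] form_commute[OF m diffs(1)] mem by simp
  moreover have "k * a d vh = k * a d v + \<tau> * a ?de Ld"
    using correction[OF mem(7)] Ld[OF mem(3)] Ld[OF mem(5)] form_commute[OF m mem(7)] mem by simp
  then have "a d vh = a d v + \<tau> / k * a ?de Ld" using \<open>k > 0\<close> by (simp add: field_simps)
  moreover have "\<tau> * F vh = k * m ?dv vh + \<tau> * a d vh"
    using corrector[OF mem(5)] \<open>\<tau> > 0\<close> by (simp add: field_simps)
  moreover have "\<tau> * a d v = a ?dd d"
    using form_scale_left[OF a diffs(2) mem(1), of "inverse \<tau>"] form_commute[OF a mem(1,3)] \<open>\<tau> > 0\<close>
    unfolding velocity by simp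
  ultimately have "\<tau> * F vh = k * m ?dv v + a ?dd d + \<tau> * a ?de ?dv + \<tau>\<^sup>2 / k * a ?de Ld"
    by (simp add: power2_eq_square algebra_simps)
  then have "2 * \<tau> * F vh = k * (2 * m ?dv v) + 2 * a ?dd d + 2 * \<tau> * a ?de ?dv + 2 * \<tau>\<^sup>2 / k * a ?de Ld"
    by (simp add: algebra_simps)
  then show ?thesis
    unfolding form_polarization[OF W m mem(3,4)] form_polarization[OF W a mem(1,2)] .
qed

section \<open>Discrete Gronwall inequality and time step restriction\<close>

text \<open>Each step multiplies \<open>X\<close> by at most \<open>1 / (1 - \<theta>) = 1 + \<theta> / (1 - \<theta>)\<close>.\<close>
lemma discrete_gronwall:
  fixes X :: "nat \<Rightarrow> real"
  assumes step: "\<And>n. n < N \<Longrightarrow> X (Suc n) \<le> X n + \<theta> * X (Suc n)"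
    and \<theta>: "0 \<le> \<theta>" "\<theta> < 1" and "0 \<le> X 0" and "n \<le> N"
  shows "X n \<le> exp (\<theta> / (1 - \<theta>) * real n) * X 0"
  using \<open>n \<le> N\<close>
proof (induction n)
  case (Suc n)
  have "0 \<le> exp (\<theta> / (1 - \<theta>) * real n) * X 0" using assms(4) by simp
  have "1 / (1 - \<theta>) = 1 + \<theta> / (1 - \<theta>)" using \<theta> by (simp add: field_simps)
  also have "\<dots> \<le> exp (\<theta> / (1 - \<theta>))" by (rule exp_ge_add_one_self)
  finally have growth: "1 / (1 - \<theta>) \<le> exp (\<theta> / (1 - \<theta>))" .
  have "X (Suc n) \<le> 1 / (1 - \<theta>) * X n" using step[of n] Suc.prems \<theta> by (simp add: field_simps)
  also have "\<dots> \<le> 1 / (1 - \<theta>) * (exp (\<theta> / (1 - \<theta>) * real n) * X 0)"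
    using Suc \<theta> by (intro mult_left_mono) auto
  also have "\<dots> \<le> exp (\<theta> / (1 - \<theta>)) * (exp (\<theta> / (1 - \<theta>) * real n) * X 0)"
    using growth assms(4) by (intro mult_right_mono) auto
  finally show ?case by (simp add: algebra_simps add_divide_distrib exp_add)
qed simp

text \<open>The exponents \<open>2 / 3\<close> and \<open>4 / 3\<close> become integers in the cube. This is the form in which the restriction
  meets the squared inverse inequality.\<close>
lemma time_step_restriction_cubed:
  fixes k C h \<tau> \<alpha> :: real
  assumes "\<tau> \<le> \<alpha> * (k / C) powr (2 / 3) * h powr (4 / 3)"
    and pos: "0 < \<tau>" "0 < k" "0 < C" "0 < \<alpha>" "0 \<le> h"
  shows "\<tau> ^ 3 * (C / h\<^sup>2)\<^sup>2 \<le> \<alpha> ^ 3 * k\<^sup>2"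
proof -
  have h: "h > 0" using assms by (cases "h = 0") auto
  have "((k / C) powr (2 / 3)) ^ 3 = (k / C)\<^sup>2" "(h powr (4 / 3)) ^ 3 = h ^ 4"
    using pos h by (simp_all add: powr_powr flip: powr_numeral)
  moreover have "\<tau> ^ 3 \<le> (\<alpha> * (k / C) powr (2 / 3) * h powr (4 / 3)) ^ 3"
    using assms by (intro power_mono) auto
  ultimately have "\<tau> ^ 3 \<le> \<alpha> ^ 3 * (k / C)\<^sup>2 * h ^ 4" by (simp add: power_mult_distrib)
  then have "\<tau> ^ 3 * (C / h\<^sup>2)\<^sup>2 \<le> \<alpha> ^ 3 * (k / C)\<^sup>2 * h ^ 4 * (C / h\<^sup>2)\<^sup>2"
    by (intro mult_right_mono) auto
  also have "\<dots> = \<alpha> ^ 3 * k\<^sup>2" using h pos by (simp add: power_divide field_simps flip: power_mult)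
  finally show ?thesis .
qed

lemma mesh_size_nonneg:
  assumes "simplicial_mesh m X \<T>" "X \<noteq> {}"
  shows "0 \<le> mesh_size \<T>"
proof -
  note mesh = simplicial_meshD[OF assms(1)]
  obtain K where K: "K \<in> \<T>" using mesh(2) assms(2) by blast
  have "0 \<le> diameter K" using mesh(4)[OF K] by (simp add: diameter_ge_0 compact_imp_bounded)
  also have "\<dots> \<le> mesh_size \<T>" unfolding mesh_size_def using mesh(1) K by simp
  finally show ?thesis .
qed

section \<open>Energy balance of one step of the splitting algorithm\<close>
lemma function_subspace_W_space:
  assumes "function_subspace (adm P)"
  shows "function_subspace (W_space P \<S>)"
proof -
  have P1: "P1_on K (\<lambda>_. 0)"
    "P1_on K f \<Longrightarrow> P1_on K g \<Longrightarrow> P1_on K (\<lambda>x. f x + g x)"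
    "P1_on K f \<Longrightarrow> P1_on K (\<lambda>x. c *\<^sub>R f x)"
    for K :: "(real ^ 'a) set" and f g :: "real ^ 'a \<Rightarrow> real ^ 'a" and c
  proof -
    show "P1_on K (\<lambda>_. 0)" unfolding P1_on_def
      by (intro exI[of _ "\<lambda>_. 0"] exI[of _ 0]) (simp add: linear_zero)
  next
    assume "P1_on K f" "P1_on K g"
    then obtain l b l' b' where "linear l" "\<forall>x\<in>K. f x = l x + b" "linear l'" "\<forall>x\<in>K. g x = l' x + b'"
      unfolding P1_on_def by metis
    then show "P1_on K (\<lambda>x. f x + g x)" unfolding P1_on_def
      by (intro exI[of _ "\<lambda>x. l x + l' x"] exI[of _ "b + b'"]) (simp add: linear_compose_add)
  next
    assume "P1_on K f"
    then obtain l b where "linear l" "\<forall>x\<in>K. f x = l x + b" unfolding P1_on_def by metis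
    then show "P1_on K (\<lambda>x. c *\<^sub>R f x)" unfolding P1_on_def
      by (intro exI[of _ "\<lambda>x. c *\<^sub>R l x"] exI[of _ "c *\<^sub>R b"])
         (simp add: linear_compose_scale_right scaleR_add_right)
  qed
  then show ?thesis using assms unfolding function_subspace_def W_space_def by auto
qed

lemma sym_bilinear_on_subset: "sym_bilinear_on X a \<Longrightarrow> Y \<subseteq> X \<Longrightarrow> sym_bilinear_on Y a"
  unfolding sym_bilinear_on_def by (simp add: subset_iff)

locale splitting_run =
  fixes P :: "'d::finite fsi" and \<T> \<S> :: "(real ^ 'd) set set"
    and L :: "(real ^ 'd \<Rightarrow> real ^ 'd) \<Rightarrow> (real ^ 'd \<Rightarrow> real ^ 'd)"
    and r N :: nat and \<tau> :: real
    and u0 d0 d1 \<phi>0 :: "real ^ 'd \<Rightarrow> real ^ 'd"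
    and u l dh d d' \<phi> :: "nat \<Rightarrow> real ^ 'd \<Rightarrow> real ^ 'd"
    and p :: "nat \<Rightarrow> real ^ 'd \<Rightarrow> real"
  assumes dim: "CARD('d) \<ge> 2"
    and problem: "fsi_problem P"
    and fluid_mesh: "simplicial_mesh CARD('d) (closure (fluid_dom P)) \<T>"
    and solid_mesh: "simplicial_mesh (CARD('d) - 1) (midsurf P) \<S>"
    and elastic_operator: "discrete_elastic_operator P \<S> L"
    and tau: "\<tau> > 0"
    and initial: "u0 \<in> V_space P \<T>" "d0 \<in> W_space P \<S>" "d1 \<in> W_space P \<S>" "\<phi>0 \<in> W_space P \<S>"
    and algorithm: "splitting_algorithm P \<T> \<S> r \<tau> N u0 d0 d1 \<phi>0 u p l dh d d' \<phi>"
    and immersed: "\<And>n. n \<le> N \<Longrightarrow> \<phi> n ` midsurf P \<subseteq> fluid_dom P"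
begin

abbreviation "W \<equiv> W_space P \<S>"
abbreviation "k \<equiv> rho_s P * thick P"

lemma k_pos: "k > 0" using problem unfolding fsi_problem_def by blast

lemma W_subspace: "function_subspace W"
  using problem unfolding fsi_problem_def by (intro function_subspace_W_space) blast

lemma W_adm: "W \<subseteq> adm P" unfolding W_space_def by blast

lemma elas_form: "sym_bilinear_on W (elas P)"
  using problem W_adm sym_bilinear_on_subset unfolding fsi_problem_def by blast

lemma elas_nonneg:
  assumes "w \<in> W"
  shows "0 \<le> elas P w w"
proof -
  obtain c where c: "c > 0" "\<forall>w\<in>adm P. c * (H1_surface_norm (midsurf P) w)\<^sup>2 \<le> elas P w w"
    using problem unfolding fsi_problem_def by blast
  have "0 \<le> c * (H1_surface_norm (midsurf P) w)\<^sup>2" using c by simp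
  also have "\<dots> \<le> elas P w w" using c assms W_adm by blast
  finally show ?thesis .
qed

lemma norm_s_power2: "w \<in> W \<Longrightarrow> (norm_s P w)\<^sup>2 = elas P w w"
  unfolding norm_s_def using elas_nonneg by simp

lemma midsurf_continuous_in_L2: "continuous_on (midsurf P) f \<Longrightarrow> f \<in> L2 (surf P)"
  unfolding surf_def
proof (rule continuous_on_in_L2_surface)
  show "finite_measure (surface_measure (midsurf P))"
    using solid_mesh dim by (intro finite_measure_surface_measure[of _ \<S>]) auto
  show "compact (midsurf P)" using problem unfolding fsi_problem_def lipschitz_surface_def by blast
qed

lemma W_continuous: "w \<in> W \<Longrightarrow> continuous_on (midsurf P) w"
  unfolding W_space_def by (intro continuous_on_P1_mesh[OF solid_mesh]) auto

lemma W_in_L2: "W \<subseteq> L2 (surf P)"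
  using W_continuous midsurf_continuous_in_L2 by blast

lemma Lambda_in_L2: "Lambda_space P \<S> \<subseteq> L2 (surf P)"
  unfolding Lambda_space_def
  by (auto intro!: midsurf_continuous_in_L2 continuous_on_P1_mesh[OF solid_mesh])

lemma V_continuous: "v \<in> V_space P \<T> \<Longrightarrow> continuous_on (closure (fluid_dom P)) v"
  unfolding V_space_def by (intro continuous_on_P1_mesh[OF fluid_mesh]) auto

lemma V_in_L2: "V_space P \<T> \<subseteq> L2 (vol P)"
  using V_continuous problem unfolding vol_def fsi_problem_def lipschitz_domain_def
  by (auto intro!: continuous_on_in_L2_lebesgue_on)

lemma surf_form: "sym_bilinear_on W (L2_inner (surf P))"
  using sym_bilinear_on_L2 W_in_L2 by (rule sym_bilinear_on_subset)

lemma step1: "n < N \<Longrightarrow> splitting_step1 P \<T> \<S> r \<tau> u p l dh d d' \<phi> (Suc n)"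
  and step2: "n < N \<Longrightarrow> splitting_step2 P \<S> \<tau> l d d' (Suc n)"
  and step3: "n < N \<Longrightarrow> splitting_step3 P d \<phi> (Suc n)"
  and start: "u 0 = u0" "d 0 = d0" "d' 0 = d1" "\<phi> 0 = \<phi>0"
  using algorithm unfolding splitting_algorithm_def by auto

lemma iterates_in_spaces:
  assumes "n \<le> N"
  shows "u n \<in> V_space P \<T>" "d n \<in> W" "d' n \<in> W"
  using assms step1[of "n - 1"] step2[of "n - 1"] start initial
  unfolding splitting_step1_def splitting_step2_def by (cases n; simp)+

lemma W_vanishes: "w \<in> W \<Longrightarrow> x \<notin> midsurf P \<Longrightarrow> w x = 0"
  using W_adm problem
  unfolding fsi_problem_def componentwise_def H1_0_surface_def H1_surface_def
  by (fastforce simp: vec_eq_iff)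

text \<open>The algorithm prescribes the velocity as a difference quotient on the mid-surface only. Since admissible functions vanish
  elsewhere, the relation is an equality of functions and can be inserted into the
  elastic form, which takes functions on the whole space as arguments.\<close>
lemma velocity_eq:
  assumes "n < N"
  shows "d' (Suc n) = (\<lambda>x. (d (Suc n) x - d n x) /\<^sub>R \<tau>)"
proof
  fix x
  show "d' (Suc n) x = (d (Suc n) x - d n x) /\<^sub>R \<tau>"
  proof (cases "x \<in> midsurf P")
    case True
    then show ?thesis using step2[OF assms] unfolding splitting_step2_def diff_quot_def by simp
  next
    case False
    have "n \<le> N" "Suc n \<le> N" using assms by auto
    then show ?thesis using iterates_in_spaces by (simp add: W_vanishes[OF _ False])
  qed
qed

lemma phi_continuous:
  assumes "n \<le> N"
  shows "continuous_on (midsurf P) (\<phi> n)"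
proof (cases n)
  case 0
  then show ?thesis using W_continuous initial(4) start by simp
next
  case (Suc j)
  have "continuous_on (midsurf P) (\<lambda>x. x + d n x)"
    using W_continuous iterates_in_spaces(2)[OF assms] by (intro continuous_intros)
  then show ?thesis
    using step3[of j] assms Suc unfolding splitting_step3_def by (auto cong: continuous_on_cong)
qed

text \<open>This is where the maps \<open>\<phi> n\<close> have to take values in the fluid domain: there the finite element
  functions are continuous and bounded.\<close>
lemma trace_in_L2:
  assumes "n \<le> N" "v \<in> V_space P \<T>"
  shows "(\<lambda>x. v (\<phi> n x)) \<in> L2 (surf P)"
proof (intro midsurf_continuous_in_L2 continuous_on_compose2[OF V_continuous[OF assms(2)]])
  show "continuous_on (midsurf P) (\<phi> n)" using assms(1) by (rule phi_continuous)
  show "\<phi> n ` midsurf P \<subseteq> closure (fluid_dom P)" using immersed[OF assms(1)] closure_subset by blast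
qed

text \<open>The test functions are the velocity, the pressure and the multiplier of the step itself: the
  skew-symmetric convection term vanishes and the two divergence terms cancel.\<close>
lemma fluid_energy_balance:
  assumes "n < N"
  shows "rho_f P * (L2_norm (vol P) (u (Suc n)))\<^sup>2
      + \<tau> * (4 * visc P * (L2_norm (vol P) (sym_grad (fluid_dom P) (u (Suc n))))\<^sup>2
             + 2 * (seminorm_sh P \<T> (p (Suc n)))\<^sup>2)
      + 2 * \<tau> * c_form P (l (Suc n)) (dh (Suc n))
    \<le> rho_f P * (L2_norm (vol P) (u n))\<^sup>2"
proof -
  let ?u = "u (Suc n)" and ?p = "p (Suc n)" and ?l = "l (Suc n)" and ?v = "dh (Suc n)"
  let ?E = "sym_grad (fluid_dom P) ?u"
  note step = step1[OF assms, unfolded splitting_step1_def diff_Suc_1]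
  have mem: "?u \<in> V_space P \<T>" "?p \<in> Q_space P \<T>" "?l \<in> Lambda_space P \<S>" "?v \<in> W"
    using step by auto
  have "0 \<le> s_form P \<T> ?p ?p"
    using problem unfolding s_form_def fsi_problem_def L2_inner_def
    by (intro mult_nonneg_nonneg sum_nonneg) auto
  then have sh: "(seminorm_sh P \<T> ?p)\<^sup>2 = s_form P \<T> ?p ?p" unfolding seminorm_sh_def by simp
  \<comment> \<open>The constraint is imposed on the difference of the traces. Splitting it requires both parts to be integrable
      against the multiplier.\<close>
  have "?l \<in> L2 (surf P)" "?v \<in> L2 (surf P)" using mem Lambda_in_L2 W_in_L2 by auto
  then have interface: "c_form P ?l (\<lambda>x. ?u (\<phi> n x) - ?v x) =
      c_form P ?l (?u \<circ> \<phi> n) - c_form P ?l ?v"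
    unfolding c_form_def o_def using trace_in_L2[OF _ mem(1), of n] assms
    by (intro form_diff_right[OF function_subspace_L2 sym_bilinear_on_L2]) auto
  have uL2: "?u \<in> L2 (vol P)" "u n \<in> L2 (vol P)" using mem V_in_L2 iterates_in_spaces[of n] assms by auto
  let ?du = "\<lambda>x. ?u x - u n x"
  have "L2_inner (vol P) (diff_quot \<tau> u (Suc n)) ?u = L2_inner (vol P) ?du ?u / \<tau>"
    unfolding diff_quot_def diff_Suc_1
    using form_scale_left[OF sym_bilinear_on_L2 function_subspace_diff[OF function_subspace_L2 uL2] uL2(1)]
    by (simp add: divide_inverse mult.commute)
  moreover have "rho_f P * L2_inner (vol P) (diff_quot \<tau> u (Suc n)) ?u + b_form P (u n) ?u ?u
      + a_fh P \<T> ?u ?p ?u ?p + c_form P ?l (?u \<circ> \<phi> n) - c_form P ?l (\<lambda>x. ?u (\<phi> n x) - ?v x) = 0"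
    using step mem by blast
  moreover have "b_form P (u n) ?u ?u = 0" unfolding b_form_def by simp
  ultimately have "rho_f P * L2_inner (vol P) ?du ?u / \<tau> + 2 * visc P * (L2_norm (vol P) ?E)\<^sup>2
      + (seminorm_sh P \<T> ?p)\<^sup>2 + c_form P ?l ?v = 0"
    unfolding interface a_fh_def a_f_def sh L2_norm_power2 by simp
  then have "rho_f P * (2 * L2_inner (vol P) ?du ?u)
      + \<tau> * (4 * visc P * (L2_norm (vol P) ?E)\<^sup>2 + 2 * (seminorm_sh P \<T> ?p)\<^sup>2)
      + 2 * \<tau> * c_form P ?l ?v = 0"
    using tau by (simp add: field_simps)
  moreover have "L2_inner (vol P) ?du ?du \<ge> 0" unfolding L2_inner_def by simp
  then have "2 * L2_inner (vol P) ?du ?u \<ge> (L2_norm (vol P) ?u)\<^sup>2 - (L2_norm (vol P) (u n))\<^sup>2"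
    unfolding form_polarization[OF function_subspace_L2 sym_bilinear_on_L2 uL2] L2_norm_power2 by simp
  moreover have "rho_f P > 0" using problem unfolding fsi_problem_def by blast
  ultimately show ?thesis
    using mult_left_mono[of "(L2_norm (vol P) ?u)\<^sup>2 - (L2_norm (vol P) (u n))\<^sup>2"
      "2 * L2_inner (vol P) ?du ?u" "rho_f P"] by (simp add: algebra_simps)
qed

abbreviation "E n \<equiv> energy P (u n) (d' n) (d n)"
abbreviation "D n \<equiv> dissipation P \<T> \<tau> u p n"

lemma L_mem: "w \<in> W \<Longrightarrow> L w \<in> W"
  and L_weak: "w \<in> W \<Longrightarrow> z \<in> W \<Longrightarrow> L2_inner (surf P) (L w) z = elas P w z"
  using elastic_operator W_adm unfolding discrete_elastic_operator_def by blast+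

lemma extrapolated_mem: "n \<le> N \<Longrightarrow> extrapolated r \<tau> d d' (Suc n) \<in> W"
  unfolding extrapolated_def using iterates_in_spaces[of n] W_subspace
  by (auto intro: function_subspace_add function_subspace_scale)

text \<open>The nonnegative numerical dissipation of backward Euler is dropped here; the two splitting terms
  are kept, because their sign depends on the extrapolation.\<close>
lemma energy_step:
  assumes "n < N"
  shows "E (Suc n) + D (Suc n)
      + 2 * \<tau> * elas P (\<lambda>x. d (Suc n) x - extrapolated r \<tau> d d' (Suc n) x) (\<lambda>x. d' (Suc n) x - d' n x)
      + 2 * \<tau>\<^sup>2 / k * elas P (\<lambda>x. d (Suc n) x - extrapolated r \<tau> d d' (Suc n) x) (L (d (Suc n)))
    \<le> E n + D n"
proof -
  let ?e = "extrapolated r \<tau> d d' (Suc n)"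
  let ?dv = "\<lambda>x. d' (Suc n) x - d' n x" and ?dd = "\<lambda>x. d (Suc n) x - d n x"
  have "n \<le> N" "Suc n \<le> N" using assms by auto
  note mem = iterates_in_spaces[OF this(1)] iterates_in_spaces[OF this(2)] extrapolated_mem[OF this(1)]
  have diffs: "?dv \<in> W" "?dd \<in> W" using mem by (auto intro: function_subspace_diff[OF W_subspace])
  note step = step1[OF assms, unfolded splitting_step1_def diff_Suc_1]
  have "k * L2_inner (surf P) (diff_quot \<tau> d' (Suc n)) w = k / \<tau> * L2_inner (surf P) ?dv w" if "w \<in> W" for w
    unfolding diff_quot_def diff_Suc_1 using form_scale_left[OF surf_form diffs(1) that]
    by (simp add: divide_inverse)
  then have corrector: "k / \<tau> * L2_inner (surf P) ?dv w + elas P (d (Suc n)) w = c_form P (l (Suc n)) w"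
    if "w \<in> W" for w
    using step2[OF assms] that unfolding splitting_step2_def by simp
  have work: "2 * \<tau> * c_form P (l (Suc n)) (dh (Suc n)) =
      k * (L2_inner (surf P) (d' (Suc n)) (d' (Suc n)) - L2_inner (surf P) (d' n) (d' n)
           + L2_inner (surf P) ?dv ?dv)
      + (elas P (d (Suc n)) (d (Suc n)) - elas P (d n) (d n) + elas P ?dd ?dd)
      + 2 * \<tau> * elas P (\<lambda>x. d (Suc n) x - ?e x) ?dv
      + 2 * \<tau>\<^sup>2 / k * elas P (\<lambda>x. d (Suc n) x - ?e x) (L (d (Suc n)))"
  proof (rule structure_energy_identity[where F = "c_form P (l (Suc n))",
        OF W_subspace surf_form elas_form k_pos tau])
    show "dh (Suc n) \<in> W" using step by blast
    show "k / \<tau> * L2_inner (surf P) (\<lambda>x. dh (Suc n) x - d' n x) w =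
        c_form P (l (Suc n)) w - elas P ?e w" if "w \<in> W" for w
      using step that by blast
    show "L2_inner (surf P) (L (d (Suc n))) w = elas P (d (Suc n)) w" if "w \<in> W" for w
      using L_weak mem that by blast
  qed (use mem corrector L_mem velocity_eq[OF assms] in blast)+
  have "0 \<le> k * L2_inner (surf P) ?dv ?dv" using k_pos unfolding L2_inner_def by simp
  moreover have "0 \<le> elas P ?dd ?dd" using elas_nonneg diffs by blast
  ultimately show ?thesis
    using fluid_energy_balance[OF assms] work mem
    unfolding energy_def dissipation_def
    by (simp add: norm_s_power2 L2_norm_power2 right_diff_distrib distrib_left)
qed

section \<open>Stability of the two schemes\<close>
lemma dissipation_nonneg: "0 \<le> D n"
  using problem tau unfolding dissipation_def fsi_problem_def by (auto intro!: sum_nonneg)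

lemma energy_nonneg: "0 \<le> E n"
  using problem k_pos unfolding energy_def fsi_problem_def by auto

lemma first_order_stability:
  assumes r: "r = 1" and "n \<le> N"
  shows "E n + D n + \<tau>\<^sup>2 * (norm_s P (d' n))\<^sup>2 + \<tau>\<^sup>2 / k * (L2_norm (surf P) (L (d n)))\<^sup>2
      \<le> E 0 + \<tau>\<^sup>2 * (norm_s P (d' 0))\<^sup>2 + \<tau>\<^sup>2 / k * (L2_norm (surf P) (L (d 0)))\<^sup>2"
  using \<open>n \<le> N\<close>
proof (induction n)
  case 0
  then show ?case by (simp add: dissipation_def)
next
  case (Suc n)
  let ?d = "d (Suc n)" and ?v = "d' (Suc n)" and ?m = "L2_inner (surf P)"
  let ?dv = "\<lambda>x. ?v x - d' n x" and ?dd = "\<lambda>x. ?d x - d n x"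
  let ?dL = "\<lambda>x. L ?d x - L (d n) x"
  have n: "n < N" "n \<le> N" using Suc.prems by auto
  note mem = iterates_in_spaces[OF n(2)] iterates_in_spaces[OF Suc.prems]
  have diffs: "?dv \<in> W" "?dd \<in> W" "?dL \<in> W"
    using mem L_mem by (auto intro: function_subspace_diff[OF W_subspace])
  \<comment> \<open>The first splitting term telescopes in the elastic norm of the velocity, the second one in the
      \<open>L\<^sup>2\<close> norm of \<open>L d\<close>.\<close>
  have "?dd = (\<lambda>x. \<tau> *\<^sub>R ?v x)" using velocity_eq[OF n(1)] tau by (simp add: fun_eq_iff)
  then have "elas P ?dd ?dv = \<tau> * elas P ?dv ?v"
    using form_scale_left[OF elas_form mem(6) diffs(1)] form_commute[OF elas_form mem(6) diffs(1)] by simp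
  then have "2 * \<tau> * elas P ?dd ?dv = \<tau>\<^sup>2 * (2 * elas P ?dv ?v)"
    by (simp add: power2_eq_square)
  also have "\<dots> = \<tau>\<^sup>2 * (elas P ?v ?v - elas P (d' n) (d' n) + elas P ?dv ?dv)"
    unfolding form_polarization[OF W_subspace elas_form mem(6,3)] ..
  also have "\<dots> \<ge> \<tau>\<^sup>2 * (elas P ?v ?v - elas P (d' n) (d' n))"
    using elas_nonneg[OF diffs(1)] by (intro mult_left_mono) auto
  finally have velocity: "\<tau>\<^sup>2 * (elas P ?v ?v - elas P (d' n) (d' n)) \<le> 2 * \<tau> * elas P ?dd ?dv" .
  have "elas P ?dd (L ?d) = ?m ?dL (L ?d)"
    using mem L_mem by (simp add: form_diff_left[OF W_subspace elas_form] form_diff_left[OF W_subspace surf_form] L_weak)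
  then have "2 * \<tau>\<^sup>2 / k * elas P ?dd (L ?d) = \<tau>\<^sup>2 / k * (2 * ?m ?dL (L ?d))" by simp
  also have "\<dots> = \<tau>\<^sup>2 / k * (?m (L ?d) (L ?d) - ?m (L (d n)) (L (d n)) + ?m ?dL ?dL)"
    unfolding form_polarization[OF W_subspace surf_form L_mem[OF mem(5)] L_mem[OF mem(2)]] ..
  also have "\<dots> \<ge> \<tau>\<^sup>2 / k * (?m (L ?d) (L ?d) - ?m (L (d n)) (L (d n)))"
    using k_pos by (intro mult_left_mono) (auto simp: L2_inner_def)
  finally have operator: "\<tau>\<^sup>2 / k * (?m (L ?d) (L ?d) - ?m (L (d n)) (L (d n)))
      \<le> 2 * \<tau>\<^sup>2 / k * elas P ?dd (L ?d)" .
  have "E (Suc n) + D (Suc n) + 2 * \<tau> * elas P ?dd ?dv + 2 * \<tau>\<^sup>2 / k * elas P ?dd (L ?d) \<le> E n + D n"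
    using energy_step[OF n(1)] r unfolding extrapolated_def by simp
  with velocity operator Suc.IH[OF n(2)] show ?case
    using mem by (simp add: norm_s_power2 L2_norm_power2 right_diff_distrib)
qed

lemma second_order_stability:
  assumes r: "r = 2" and "C > 0" and "\<alpha> > 0"
    and inverse: "\<And>w. w \<in> W \<Longrightarrow> norm_s P (L w) \<le> C / (mesh_size \<S>)\<^sup>2 * norm_s P w"
    and cfl: "\<tau> \<le> \<alpha> * (k / C) powr (2 / 3) * mesh_size \<S> powr (4 / 3)"
    and small: "2 * \<tau> * \<alpha> ^ 3 < 1"
    and "n \<le> N"
  shows "E n + D n \<le> exp (2 * \<alpha> ^ 3 * (real n * \<tau>) / (1 - 2 * \<tau> * \<alpha> ^ 3)) * E 0"
proof -
  let ?\<theta> = "2 * \<tau> * \<alpha> ^ 3"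
  let ?K = "C / (mesh_size \<S>)\<^sup>2"
  have "0 \<le> mesh_size \<S>" using mesh_size_nonneg[OF solid_mesh] problem
    unfolding fsi_problem_def lipschitz_surface_def by blast
  then have K: "\<tau> ^ 3 * ?K\<^sup>2 \<le> \<alpha> ^ 3 * k\<^sup>2"
    using time_step_restriction_cubed[OF cfl tau k_pos \<open>C > 0\<close> \<open>\<alpha> > 0\<close>] by blast
  have \<theta>: "0 \<le> ?\<theta>" using tau \<open>\<alpha> > 0\<close> by simp
  have step: "E (Suc j) + D (Suc j) \<le> E j + D j + ?\<theta> * (E (Suc j) + D (Suc j))" if "j < N" for j
  proof -
    let ?d = "d (Suc j)" and ?v = "d' (Suc j)" and ?e = "extrapolated r \<tau> d d' (Suc j)"
    let ?dv = "\<lambda>x. ?v x - d' j x"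
    have j: "j \<le> N" "Suc j \<le> N" using that by auto
    note mem = iterates_in_spaces[OF j(1)] iterates_in_spaces[OF j(2)]
    have dv: "?dv \<in> W" using mem by (auto intro: function_subspace_diff[OF W_subspace])
    have Ld: "L ?d \<in> W" using mem L_mem by blast
    have "(\<lambda>x. ?d x - ?e x) = (\<lambda>x. \<tau> *\<^sub>R ?dv x)"
      using velocity_eq[OF that] tau r
      by (simp add: extrapolated_def scaleR_diff_right flip: diff_diff_eq)
    then have e: "elas P (\<lambda>x. ?d x - ?e x) w = \<tau> * elas P ?dv w" if "w \<in> W" for w
      using form_scale_left[OF elas_form dv that] by simp
    have "(norm_s P (L ?d))\<^sup>2 \<le> (?K * norm_s P ?d)\<^sup>2"
      using inverse[OF mem(5)] elas_nonneg[OF Ld] by (intro power_mono) (auto simp: norm_s_def)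
    then have inv: "elas P (L ?d) (L ?d) \<le> ?K\<^sup>2 * elas P ?d ?d"
      unfolding power_mult_distrib norm_s_power2[OF Ld] norm_s_power2[OF mem(5)] .
    \<comment> \<open>Completing the square: with the weight \<open>\<tau> / (2 k)\<close> the cross term is exactly the second splitting
        term.\<close>
    have "0 \<le> elas P (\<lambda>x. ?dv x + (\<tau> / (2 * k)) *\<^sub>R L ?d x) (\<lambda>x. ?dv x + (\<tau> / (2 * k)) *\<^sub>R L ?d x)"
      using dv Ld W_subspace by (intro elas_nonneg function_subspace_add function_subspace_scale)
    then have "0 \<le> 2 * \<tau>\<^sup>2 * (elas P ?dv ?dv + 2 * (\<tau> / (2 * k)) * elas P ?dv (L ?d)
        + (\<tau> / (2 * k))\<^sup>2 * elas P (L ?d) (L ?d))"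
      unfolding form_square_expand[OF W_subspace elas_form dv Ld] by simp
    also have "\<dots> = 2 * \<tau> * elas P (\<lambda>x. ?d x - ?e x) ?dv
        + 2 * \<tau>\<^sup>2 / k * elas P (\<lambda>x. ?d x - ?e x) (L ?d) + \<tau> ^ 4 / (2 * k\<^sup>2) * elas P (L ?d) (L ?d)"
      unfolding e[OF dv] e[OF Ld] using k_pos
      by (simp add: field_simps power2_eq_square power4_eq_xxxx)
    finally have square: "0 \<le> 2 * \<tau> * elas P (\<lambda>x. ?d x - ?e x) ?dv
        + 2 * \<tau>\<^sup>2 / k * elas P (\<lambda>x. ?d x - ?e x) (L ?d) + \<tau> ^ 4 / (2 * k\<^sup>2) * elas P (L ?d) (L ?d)" .
    have "\<tau> ^ 4 / (2 * k\<^sup>2) * elas P (L ?d) (L ?d) \<le> \<tau> ^ 4 / (2 * k\<^sup>2) * (?K\<^sup>2 * elas P ?d ?d)"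
      using inv tau by (intro mult_left_mono) auto
    also have "\<dots> = \<tau> / (2 * k\<^sup>2) * (\<tau> ^ 3 * ?K\<^sup>2) * elas P ?d ?d"
      by (simp add: power4_eq_xxxx power3_eq_cube)
    also have "\<dots> \<le> \<tau> / (2 * k\<^sup>2) * (\<alpha> ^ 3 * k\<^sup>2) * elas P ?d ?d"
      using K tau elas_nonneg[OF mem(5)] by (intro mult_right_mono mult_left_mono) auto
    also have "\<dots> = ?\<theta> / 4 * elas P ?d ?d"
      using less_imp_neq[OF k_pos] by simp
    \<comment> \<open>A factor 4 is given away here; the stated growth rate leaves this room.\<close>
    also have "\<dots> \<le> ?\<theta> * elas P ?d ?d"
      using \<theta> elas_nonneg[OF mem(5)] by (intro mult_right_mono) auto
    also have "\<dots> \<le> ?\<theta> * (E (Suc j) + D (Suc j))"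
      using problem k_pos dissipation_nonneg[of "Suc j"] \<theta> 
      unfolding energy_def norm_s_power2[OF mem(5)] fsi_problem_def by (intro mult_left_mono) auto
    finally show ?thesis using energy_step[OF that] square by linarith
  qed
  have "E n + D n \<le> exp (?\<theta> / (1 - ?\<theta>) * real n) * (E 0 + D 0)"
    using step energy_nonneg[of 0] dissipation_nonneg[of 0] \<theta> small \<open>n \<le> N\<close>
    by (intro discrete_gronwall[of N "\<lambda>n. E n + D n"]) auto
  then show ?thesis by (simp add: dissipation_def algebra_simps)
qed

end

theorem theorem1:
  fixes P :: "'d::finite fsi"
    and Th Sh :: "'h \<Rightarrow> (real ^ 'd) set set"
    and L :: "'h \<Rightarrow> (real ^ 'd \<Rightarrow> real ^ 'd) \<Rightarrow> (real ^ 'd \<Rightarrow> real ^ 'd)"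
    and h :: 'h
    and T \<tau> :: real and N r :: nat
    and u0 d0 d1 \<phi>0 :: "real ^ 'd \<Rightarrow> real ^ 'd"
    and u l dh d d' \<phi> :: "nat \<Rightarrow> real ^ 'd \<Rightarrow> real ^ 'd"
    and p :: "nat \<Rightarrow> real ^ 'd \<Rightarrow> real"
  assumes "CARD('d) \<in> {2, 3}"
    and "fsi_problem P"
    and "\<And>i. simplicial_mesh CARD('d) (closure (fluid_dom P)) (Th i)"
    and "\<And>i. simplicial_mesh (CARD('d) - 1) (midsurf P) (Sh i)"
    and "regular_family (range Th)" and "regular_family (range Sh)"
    and "\<And>i. discrete_elastic_operator P (Sh i) (L i)"
    and "T > 0" and "N \<ge> 1" and "\<tau> = T / real N" and "r \<in> {1, 2}"
    and "u0 \<in> V_space P (Th h)"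
    and "d0 \<in> W_space P (Sh h)" and "d1 \<in> W_space P (Sh h)" and "\<phi>0 \<in> W_space P (Sh h)"
    and "splitting_algorithm P (Th h) (Sh h) r \<tau> N u0 d0 d1 \<phi>0 u p l dh d d' \<phi>"
    and "\<And>n. n \<le> N \<Longrightarrow> \<phi> n ` midsurf P \<subseteq> fluid_dom P"
  shows
    "(r = 1 \<longrightarrow>
       (\<forall>n\<in>{1..N}.
          energy P (u n) (d' n) (d n) + dissipation P (Th h) \<tau> u p n
            + \<tau>\<^sup>2 * (norm_s P (d' n))\<^sup>2
            + \<tau>\<^sup>2 / (rho_s P * thick P) * (L2_norm (surf P) (L h (d n)))\<^sup>2
          \<le> energy P u0 d1 d0
            + \<tau>\<^sup>2 * (norm_s P d1)\<^sup>2
            + \<tau>\<^sup>2 / (rho_s P * thick P) * (L2_norm (surf P) (L h d0))\<^sup>2)) \<and>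
     (\<forall>C\<^sub>I \<alpha>.
       r = 2 \<and> quasi_uniform_family (range Sh) \<and>
       C\<^sub>I > 0 \<and>
       (\<forall>i. \<forall>w\<in>W_space P (Sh i). norm_s P (L i w) \<le> C\<^sub>I / (mesh_size (Sh i))\<^sup>2 * norm_s P w) \<and>
       \<alpha> > 0 \<and>
       \<tau> \<le> \<alpha> * (rho_s P * thick P / C\<^sub>I) powr (2 / 3) * mesh_size (Sh h) powr (4 / 3) \<and>
       2 * \<tau> * \<alpha> ^ 3 < 1 \<longrightarrow>
       (\<forall>n\<in>{1..N}.
          energy P (u n) (d' n) (d n) + dissipation P (Th h) \<tau> u p n
          \<le> exp (2 * \<alpha> ^ 3 * (real n * \<tau>) / (1 - 2 * \<tau> * \<alpha> ^ 3)) * energy P u0 d1 d0))"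
proof -
  have "\<tau> > 0" using assms(8-10) by simp
  then interpret splitting_run P "Th h" "Sh h" "L h" r N \<tau> u0 d0 d1 \<phi>0 u l dh d d' \<phi> p
    using assms by unfold_locales auto
  show ?thesis
    using first_order_stability second_order_stability unfolding start by auto
qed

end
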